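(* Let $V$ be a Whittaker module of type $\eta$ for $U$. Then the annihilator of $V$ is centrally generated, i.e. $$\mathrm{Ann}_{U}(V)=U\,\mathrm{Ann}_{Z(U)}(V).$$
   Context: Let $q\in\mathbb{C}$ be nonzero and not a root of unity, and let $m\geq 1$ be an integer. Put $f_m(K)=\frac{K^{m}-K^{-m}}{q-q^{-1}}$. $U=U_q(f_m(K))$ is the associative unital $\mathbb{C}$-algebra generated by $E,F,K^{\pm1}$ with relations $KE=q^{2}EK$, $KF=q^{-2}FK$, $KK^{-1}=K^{-1}K=1$, $EF-FE=f_m(K)$; $Z(U)$ is its center. $U_q(E)$ is the subalgebra generated by $E$. Fix an algebra homomorphism $\eta\colon U_q(E)\to\mathbb{C}$ with $\eta(E)\neq 0$. In a left $U$-module $V$, a nonzero vector $v$ is a Whittaker vector of type $\eta$ if $Ev=\eta(E)v$; if moreover $V=Uv$, then $V$ is a Whittaker module of type $\eta$. $\mathrm{Ann}_{U}(V)=\{u\in U: uV=0\}$ and $\mathrm{Ann}_{Z(U)}(V)=\mathrm{Ann}_U(V)\cap Z(U)$. *)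

theory Defs
  imports
    "HOL-Library.Poly_Mapping"
    "HOL-Algebra.Algebra"
    "HOL-Algebra.Algebraic_Closure_Type"
begin

section \<open>The free algebra on four generators\<close>

text \<open>
  The free monoid is written additively because the convolution product of
  \<open>_ \<Rightarrow>\<^sub>0 _\<close> multiplies monomials by adding their exponents; the addition is
  concatenation and is not commutative.  Hence \<open>gen free_monoid \<Rightarrow>\<^sub>0 complex\<close> is the free
  associative unital algebra \<open>\<complex>\<langle>E, F, K, K\<^sup>-\<^sup>1\<rangle>\<close>.
\<close>

datatype 'a free_monoid = Word (letters: "'a list")

instantiation free_monoid :: (type) monoid_add
begin

definition zero_free_monoid :: "'a free_monoid"
  where "zero_free_monoid = Word []"

definition plus_free_monoid :: "'a free_monoid \<Rightarrow> 'a free_monoid \<Rightarrow> 'a free_monoid"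
  where "plus_free_monoid v w = Word (letters v @ letters w)"

instance
  by standard (simp_all add: zero_free_monoid_def plus_free_monoid_def)

end

datatype gen = GenE | GenF | GenK | GenKinv

type_synonym free_alg = "gen free_monoid \<Rightarrow>\<^sub>0 complex"

definition var :: "gen \<Rightarrow> free_alg"
  where "var g = Poly_Mapping.single (Word [g]) 1"

definition const :: "complex \<Rightarrow> free_alg"
  where "const c = Poly_Mapping.single 0 c"

abbreviation FreeAlg :: "free_alg ring"
  where "FreeAlg \<equiv> ring_of_type_algebra"


section \<open>The algebra \<open>U\<^sub>q(f\<^sub>m(K))\<close>\<close>

definition f_poly :: "complex \<Rightarrow> nat \<Rightarrow> free_alg"
  where "f_poly q m = const (1 / (q - inverse q)) * (var GenK ^ m - var GenKinv ^ m)"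

definition Uq_relators :: "complex \<Rightarrow> nat \<Rightarrow> free_alg set"
  where "Uq_relators q m =
    { var GenK * var GenE - const (q\<^sup>2) * (var GenE * var GenK),
      var GenK * var GenF - const (inverse (q\<^sup>2)) * (var GenF * var GenK),
      var GenK * var GenKinv - 1,
      var GenKinv * var GenK - 1,
      var GenE * var GenF - var GenF * var GenE - f_poly q m }"

text \<open>\<^const>\<open>genideal\<close> is the generated two-sided ideal.\<close>

definition Uq_ideal :: "complex \<Rightarrow> nat \<Rightarrow> free_alg set"
  where "Uq_ideal q m = Idl\<^bsub>FreeAlg\<^esub> (Uq_relators q m)"

definition Uq :: "complex \<Rightarrow> nat \<Rightarrow> free_alg set ring"
  where "Uq q m = FreeAlg Quot (Uq_ideal q m)"

definition Uq_class :: "complex \<Rightarrow> nat \<Rightarrow> free_alg \<Rightarrow> free_alg set"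
  where "Uq_class q m x = Uq_ideal q m +>\<^bsub>FreeAlg\<^esub> x"

definition Uq_scalar :: "complex \<Rightarrow> nat \<Rightarrow> complex \<Rightarrow> free_alg set"
  where "Uq_scalar q m c = Uq_class q m (const c)"

definition Uq_E :: "complex \<Rightarrow> nat \<Rightarrow> free_alg set"
  where "Uq_E q m = Uq_class q m (var GenE)"

text \<open>The subalgebra generated by \<open>E\<close>: a subalgebra is a subring containing the scalars.\<close>

definition Uq_subalg_E :: "complex \<Rightarrow> nat \<Rightarrow> free_alg set set"
  where "Uq_subalg_E q m = generate_ring (Uq q m) (range (Uq_scalar q m) \<union> {Uq_E q m})"

text \<open>Only the values of \<open>\<eta>\<close> on the subalgebra generated by \<open>E\<close> matter.\<close>

definition Uq_E_character :: "complex \<Rightarrow> nat \<Rightarrow> (free_alg set \<Rightarrow> complex) \<Rightarrow> bool"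
  where "Uq_E_character q m \<eta> \<longleftrightarrow>
    \<eta> \<in> ring_hom ((Uq q m)\<lparr>carrier := Uq_subalg_E q m\<rparr>) ring_of_type_algebra \<and>
    (\<forall>c. \<eta> (Uq_scalar q m c) = c)"


section \<open>Left modules, annihilators and Whittaker modules\<close>

definition ring_center :: "('a, 'b) ring_scheme \<Rightarrow> 'a set"
  where "ring_center R =
    {z \<in> carrier R. \<forall>x \<in> carrier R. z \<otimes>\<^bsub>R\<^esub> x = x \<otimes>\<^bsub>R\<^esub> z}"

text \<open>
  The locale \<^locale>\<open>module\<close> requires a commutative ring; the following has the same axioms over
  an arbitrary one.  The \<open>\<complex>\<close>-vector space structure of a module over an algebra is
  the one induced by the scalars of the algebra.
\<close>

locale left_module = R?: ring R + M?: abelian_group M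
  for R :: "('a, 'c) ring_scheme" (structure) and M :: "('a, 'b, 'd) module_scheme" (structure) +
  assumes smult_closed: "a \<in> carrier R \<Longrightarrow> x \<in> carrier M \<Longrightarrow> a \<odot>\<^bsub>M\<^esub> x \<in> carrier M"
    and smult_l_distr: "a \<in> carrier R \<Longrightarrow> b \<in> carrier R \<Longrightarrow> x \<in> carrier M \<Longrightarrow>
      (a \<oplus>\<^bsub>R\<^esub> b) \<odot>\<^bsub>M\<^esub> x = a \<odot>\<^bsub>M\<^esub> x \<oplus>\<^bsub>M\<^esub> b \<odot>\<^bsub>M\<^esub> x"
    and smult_r_distr: "a \<in> carrier R \<Longrightarrow> x \<in> carrier M \<Longrightarrow> y \<in> carrier M \<Longrightarrow>
      a \<odot>\<^bsub>M\<^esub> (x \<oplus>\<^bsub>M\<^esub> y) = a \<odot>\<^bsub>M\<^esub> x \<oplus>\<^bsub>M\<^esub> a \<odot>\<^bsub>M\<^esub> y"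
    and smult_assoc: "a \<in> carrier R \<Longrightarrow> b \<in> carrier R \<Longrightarrow> x \<in> carrier M \<Longrightarrow>
      (a \<otimes>\<^bsub>R\<^esub> b) \<odot>\<^bsub>M\<^esub> x = a \<odot>\<^bsub>M\<^esub> (b \<odot>\<^bsub>M\<^esub> x)"
    and smult_one: "x \<in> carrier M \<Longrightarrow> \<one>\<^bsub>R\<^esub> \<odot>\<^bsub>M\<^esub> x = x"

definition Ann :: "('a, 'c) ring_scheme \<Rightarrow> ('a, 'b, 'd) module_scheme \<Rightarrow> 'a set"
  where "Ann R M = {u \<in> carrier R. \<forall>x \<in> carrier M. u \<odot>\<^bsub>M\<^esub> x = \<zero>\<^bsub>M\<^esub>}"

definition Ann_center :: "('a, 'c) ring_scheme \<Rightarrow> ('a, 'b, 'd) module_scheme \<Rightarrow> 'a set"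
  where "Ann_center R M = Ann R M \<inter> ring_center R"

definition whittaker_vector ::
  "complex \<Rightarrow> nat \<Rightarrow> (free_alg set \<Rightarrow> complex) \<Rightarrow> (free_alg set, 'b, 'd) module_scheme \<Rightarrow> 'b \<Rightarrow> bool"
  where "whittaker_vector q m \<eta> V v \<longleftrightarrow>
    v \<in> carrier V \<and> v \<noteq> \<zero>\<^bsub>V\<^esub> \<and>
    Uq_E q m \<odot>\<^bsub>V\<^esub> v = Uq_scalar q m (\<eta> (Uq_E q m)) \<odot>\<^bsub>V\<^esub> v"

definition whittaker_module ::
  "complex \<Rightarrow> nat \<Rightarrow> (free_alg set \<Rightarrow> complex) \<Rightarrow> (free_alg set, 'b, 'd) module_scheme \<Rightarrow> bool"
  where "whittaker_module q m \<eta> V \<longleftrightarrow>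
    left_module (Uq q m) V \<and>
    (\<exists>v. whittaker_vector q m \<eta> V v \<and>
         carrier V = {u \<odot>\<^bsub>V\<^esub> v | u. u \<in> carrier (Uq q m)})"


section \<open>Basic facts\<close>

lemma ring_FreeAlg: "ring FreeAlg"
proof -
  have "\<exists>y. x + y = 0" for x :: free_alg
    using add.right_inverse by blast
  thus ?thesis
    unfolding ring_of_type_algebra_def using add.right_inverse
    by unfold_locales (auto simp: algebra_simps Units_def)
qed

lemma ideal_Uq_ideal: "ideal (Uq_ideal q m) FreeAlg"
  unfolding Uq_ideal_def
  by (rule ring.genideal_ideal[OF ring_FreeAlg]) (simp add: ring_of_type_algebra_def)

lemma ring_Uq: "ring (Uq q m)"
  unfolding Uq_def by (rule ideal.quotient_is_ring[OF ideal_Uq_ideal])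

lemma Uq_class_ring_hom: "Uq_class q m \<in> ring_hom FreeAlg (Uq q m)"
proof -
  have "Uq_class q m = (+>\<^bsub>FreeAlg\<^esub>) (Uq_ideal q m)"
    by (simp add: Uq_class_def fun_eq_iff)
  thus ?thesis
    unfolding Uq_def by (simp add: ideal.rcos_ring_hom[OF ideal_Uq_ideal])
qed

lemma Uq_class_relator:
  assumes "x \<in> Uq_relators q m"
  shows "Uq_class q m x = \<zero>\<^bsub>Uq q m\<^esub>"
proof -
  interpret ideal "Uq_ideal q m" FreeAlg by (rule ideal_Uq_ideal)
  have "x \<in> Uq_ideal q m"
    using assms unfolding Uq_ideal_def genideal_def by blast
  thus ?thesis
    by (simp add: Uq_class_def Uq_def FactRing_def a_rcos_const)
qed

end

theory Submission
  imports Defs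
begin

text \<open>
  Let \<open>V = U w\<close> with \<open>E w = e w\<close> and \<open>e \<noteq> 0\<close>.  Central elements that annihilate \<open>w\<close> annihilate \<open>V\<close>, so
  one has to write each \<open>u\<close> that annihilates \<open>V\<close> as a combination of central elements that kill \<open>w\<close>.

  The Casimir element \<open>\<Omega> = F E + a K\<^sup>m + b K\<^sup>-\<^sup>m\<close> is central for suitable nonzero \<open>a\<close> and \<open>b\<close>
  (\<open>casimir_central\<close>).  Let \<open>D\<close> be the subalgebra of all finite sums of terms \<open>K\<^sup>j z\<close> with \<open>z\<close> central.
  It contains \<open>F E\<close> and \<open>E F\<close>, and therefore \<open>U\<close> is the sum of the spaces \<open>D E\<^sup>n\<close> and \<open>D F\<^sup>n\<close>
  (\<open>graded_decomposition\<close>), which are eigenspaces of conjugation by \<open>K\<close>.  The annihilator is a two-sided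
  ideal, hence stable under this conjugation, and as \<open>q\<close> is not a root of unity it contains the
  components of \<open>u\<close> in these eigenspaces (\<open>weight_components_in\<close>).

  Suppose that \<open>d E\<^sup>n\<close> annihilates \<open>V\<close>, where \<open>d = \<Sum> K\<^sup>j z\<^sub>j\<close> is in \<open>D\<close>.  Then \<open>e\<^sup>n d w = 0\<close>, so
  \<open>\<Sum> K\<^sup>j z\<^sub>j w = 0\<close>.  The vectors \<open>K\<^sup>j z\<^sub>j w\<close> lie in the eigenspaces of \<open>E\<close> for the distinct
  eigenvalues \<open>e q\<^sup>-\<^sup>2\<^sup>j\<close>, so each of them vanishes (\<open>torus_components_in\<close>) and \<open>z\<^sub>j w = 0\<close>.  Hence
  \<open>d E\<^sup>n = \<Sum> K\<^sup>j E\<^sup>n z\<^sub>j\<close> is of the required form.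

  If \<open>d F\<^sup>n\<close> annihilates \<open>V\<close>, so does \<open>d F\<^sup>n E = d t F\<^sup>n\<^sup>-\<^sup>1\<close> with \<open>t = \<Omega> - a' K\<^sup>m - b' K\<^sup>-\<^sup>m\<close>
  and \<open>a' \<noteq> 0\<close>.  Inductively \<open>d t w = 0\<close>, and looking at the highest power of \<open>K\<close> one gets \<open>d w = 0\<close>
  (\<open>degree_zero_cancel\<close>, \<open>negative_weight\<close>); from there one continues as before.
\<close>


section \<open>Sums along an integer grading\<close>

text \<open>
  The summands are indexed by all integers and vanish outside a finite set, so that decompositions
  can be added and shifted.
\<close>
definition graded_sum :: "(int \<Rightarrow> 'a::ab_group_add set) \<Rightarrow> 'a set"
  where "graded_sum H = {\<Sum>n\<in>I. h n | I h. finite I \<and> (\<forall>n. h n \<in> H n) \<and> (\<forall>n. n \<notin> I \<longrightarrow> h n = 0)}"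

lemma graded_sumE:
  assumes "x \<in> graded_sum H"
  obtains I h where "finite I" "\<And>n. h n \<in> H n" "\<And>n. n \<notin> I \<Longrightarrow> h n = 0" "x = (\<Sum>n\<in>I. h n)"
  using assms unfolding graded_sum_def by blast

lemma graded_sum_component:
  assumes "\<And>k. 0 \<in> H k" and "x \<in> H n"
  shows "x \<in> graded_sum H"
  unfolding graded_sum_def
  by (rule CollectI, rule exI[of _ "{n}"], rule exI[of _ "\<lambda>k. if k = n then x else 0"])
    (use assms in auto)

lemma graded_sum_add:
  assumes closed: "\<And>n x y. x \<in> H n \<Longrightarrow> y \<in> H n \<Longrightarrow> x + y \<in> H n"
    and x: "x \<in> graded_sum H" and y: "y \<in> graded_sum H"
  shows "x + y \<in> graded_sum H"
proof -
  from x obtain I h where h: "finite I" "\<And>n. h n \<in> H n" "\<And>n. n \<notin> I \<Longrightarrow> h n = 0" "x = sum h I"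
    by (rule graded_sumE) blast
  from y obtain J g where g: "finite J" "\<And>n. g n \<in> H n" "\<And>n. n \<notin> J \<Longrightarrow> g n = 0" "y = sum g J"
    by (rule graded_sumE) blast
  have "sum h (I \<union> J) = sum h I" "sum g (I \<union> J) = sum g J"
    using h(1,3) g(1,3) by (auto intro!: sum.mono_neutral_right)
  then have "x + y = (\<Sum>n\<in>I \<union> J. h n + g n)"
    using h(4) g(4) by (simp add: sum.distrib)
  moreover have "finite (I \<union> J)" "\<And>n. h n + g n \<in> H n" "\<And>n. n \<notin> I \<union> J \<Longrightarrow> h n + g n = 0"
    using h g closed by auto
  ultimately show ?thesis
    unfolding graded_sum_def by blast
qed

lemma graded_sum_induct [consumes 1, case_names zero component add]:
  assumes "x \<in> graded_sum H"
    and "P 0" and "\<And>n x. x \<in> H n \<Longrightarrow> P x"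
    and "\<And>x y. P x \<Longrightarrow> P y \<Longrightarrow> P (x + y)"
  shows "P x"
proof -
  obtain I h where h: "finite I" "\<And>n. h n \<in> H n" "x = sum h I"
    using assms(1) by (elim graded_sumE) blast
  have "P (sum h I)"
    using h(1) by (induction I rule: finite_induct) (auto intro: assms h(2))
  then show ?thesis using h(3) by simp
qed


section \<open>Algebras modulo a two-sided ideal\<close>

text \<open>
  An algebra given by generators and relations is handled through representatives: the
  computations take place in an ordinary ring type, and equality in the quotient by \<open>J\<close> becomes the
  congruence \<open>x \<asymp> y\<close>.  Scalars act through a separate operation \<open>c \<bullet> x\<close>: as an operation it can be
  moved out of products by rewriting in one direction, which a product with a central element cannot.
\<close>
locale algebra_mod_ideal =
  fixes J :: "'a::ring_1 set"
    and scale :: "complex \<Rightarrow> 'a \<Rightarrow> 'a" (infixr \<open>\<bullet>\<close> 75)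
  assumes J_zero: "0 \<in> J"
    and J_add: "x \<in> J \<Longrightarrow> y \<in> J \<Longrightarrow> x + y \<in> J"
    and J_left: "x \<in> J \<Longrightarrow> a * x \<in> J"
    and J_right: "x \<in> J \<Longrightarrow> x * a \<in> J"
    and scale_add_right: "c \<bullet> (x + y) = c \<bullet> x + c \<bullet> y"
    and scale_add_left: "(c + d) \<bullet> x = c \<bullet> x + d \<bullet> x"
    and scale_scale [simp]: "c \<bullet> d \<bullet> x = (c * d) \<bullet> x"
    and scale_one [simp]: "1 \<bullet> x = x"
    and mult_scale_left [simp]: "(c \<bullet> x) * y = c \<bullet> (x * y)"
    and mult_scale_right [simp]: "x * (c \<bullet> y) = c \<bullet> (x * y)"
begin

lemma scale_zero_right [simp]: "c \<bullet> 0 = 0"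
  using scale_add_right[of c 0 0] by simp

lemma scale_zero_left [simp]: "0 \<bullet> x = 0"
  using scale_add_left[of 0 0 x] by simp

lemma scale_minus_right: "c \<bullet> (- x) = - (c \<bullet> x)"
  by (rule minus_unique[symmetric]) (simp add: scale_add_right[symmetric])

lemma scale_minus_left: "(- c) \<bullet> x = - (c \<bullet> x)"
  by (rule minus_unique[symmetric]) (simp add: scale_add_left[symmetric])

lemma scale_diff_right: "c \<bullet> (x - y) = c \<bullet> x - c \<bullet> y"
  using scale_add_right[of c x "- y"] by (simp add: scale_minus_right)

lemma scale_diff_left: "(c - d) \<bullet> x = c \<bullet> x - d \<bullet> x"
  using scale_add_left[of c "- d" x] by (simp add: scale_minus_left)

lemma scale_eq_mult: "c \<bullet> x = (c \<bullet> 1) * x"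
  by simp

definition cong :: "'a \<Rightarrow> 'a \<Rightarrow> bool" (infix \<open>\<asymp>\<close> 50)
  where "x \<asymp> y \<longleftrightarrow> x - y \<in> J"

text \<open>
  These are the preimages of the left ideals of the quotient by \<open>J\<close>, hence the inclusion of \<open>J\<close>.
\<close>
definition left_ideal :: "'a set \<Rightarrow> bool"
  where "left_ideal S \<longleftrightarrow>
    J \<subseteq> S \<and> (\<forall>x\<in>S. \<forall>y\<in>S. x + y \<in> S) \<and> (\<forall>a. \<forall>x\<in>S. a * x \<in> S)"

lemma left_idealD:
  assumes "left_ideal S"
  shows "x \<in> J \<Longrightarrow> x \<in> S" "0 \<in> S" "x \<in> S \<Longrightarrow> y \<in> S \<Longrightarrow> x + y \<in> S" "x \<in> S \<Longrightarrow> a * x \<in> S"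
    "x \<in> S \<Longrightarrow> c \<bullet> x \<in> S" "x \<in> S \<Longrightarrow> - x \<in> S" "x \<in> S \<Longrightarrow> y \<in> S \<Longrightarrow> x - y \<in> S"
proof -
  show *: "x \<in> J \<Longrightarrow> x \<in> S" "0 \<in> S" "x \<in> S \<Longrightarrow> y \<in> S \<Longrightarrow> x + y \<in> S"
    and mult: "\<And>a x. x \<in> S \<Longrightarrow> a * x \<in> S"
    using assms J_zero unfolding left_ideal_def by auto
  show "x \<in> S \<Longrightarrow> c \<bullet> x \<in> S"
    by (subst scale_eq_mult) (rule mult)
  show minus: "- x \<in> S" if "x \<in> S" for x
    using mult[OF that, of "- 1"] by simp
  show "x - y \<in> S" if "x \<in> S" "y \<in> S"
    using assms that(1) minus[OF that(2)] unfolding left_ideal_def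
    by (metis add_uminus_conv_diff)
qed

lemma left_ideal_J: "left_ideal J"
  unfolding left_ideal_def using J_add J_left by blast

lemmas J_minus = left_idealD(6)[OF left_ideal_J]
lemmas J_diff = left_idealD(7)[OF left_ideal_J]
lemmas J_scale = left_idealD(5)[OF left_ideal_J]

lemma cong_refl [simp, intro]: "x \<asymp> x"
  by (simp add: cong_def J_zero)

lemma cong_sym: "x \<asymp> y \<Longrightarrow> y \<asymp> x"
  unfolding cong_def using J_minus[of "x - y"] by simp

lemma cong_trans [trans]: "x \<asymp> y \<Longrightarrow> y \<asymp> z \<Longrightarrow> x \<asymp> z"
  unfolding cong_def using J_add[of "x - y" "y - z"] by simp

lemma cong_add: "x \<asymp> x' \<Longrightarrow> y \<asymp> y' \<Longrightarrow> x + y \<asymp> x' + y'"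
  unfolding cong_def using J_add[of "x - x'" "y - y'"] by (simp add: algebra_simps)

lemma cong_diff: "x \<asymp> x' \<Longrightarrow> y \<asymp> y' \<Longrightarrow> x - y \<asymp> x' - y'"
  unfolding cong_def using J_diff[of "x - x'" "y - y'"] by (simp add: algebra_simps)

lemma cong_scale: "x \<asymp> y \<Longrightarrow> c \<bullet> x \<asymp> c \<bullet> y"
  unfolding cong_def using J_scale[of "x - y" c] by (simp add: scale_diff_right)

lemma cong_left: "x \<asymp> y \<Longrightarrow> a * x \<asymp> a * y"
  unfolding cong_def using J_left[of "x - y" a] by (simp add: algebra_simps)

lemma cong_right: "x \<asymp> y \<Longrightarrow> x * a \<asymp> y * a"
  unfolding cong_def using J_right[of "x - y" a] by (simp add: algebra_simps)

lemma cong_in: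
  assumes "left_ideal S" "x \<asymp> y" "y \<in> S"
  shows "x \<in> S"
  using left_idealD(3)[OF assms(1) left_idealD(1)[OF assms(1)] assms(3), of "x - y"] assms(2)
  by (simp add: cong_def)

text \<open>
  A \<open>T\<close>-stable subspace contains the components, with respect to distinct eigenvalues, of each of its
  elements.  Applying \<open>T - l k\<close> removes the component of \<open>k\<close> and multiplies each other one by the nonzero
  number \<open>l n - l k\<close>, which gives an induction on the number of components.  The eigenvector
  equations are imposed modulo \<open>S\<close>, so that they can express the action on a vector killed by \<open>S\<close>.  The lemma is used twice: with \<open>T\<close> the left multiplication
  by \<open>E\<close> to separate powers of \<open>K\<close>, and with \<open>T\<close> the conjugation by \<open>K\<close> to separate weights.
\<close>
lemma eigencomponents_in:
  assumes S: "left_ideal S"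
    and T_add: "\<And>x y. T (x + y) = T x + T y"
    and T_scale: "\<And>c x. T (c \<bullet> x) = c \<bullet> T x"
    and T_S: "\<And>x. x \<in> S \<Longrightarrow> T x \<in> S"
    and "finite I" and "inj_on l I"
    and "\<And>n. n \<in> I \<Longrightarrow> T (h n) - l n \<bullet> h n \<in> S"
    and "sum h I \<in> S" and "n \<in> I"
  shows "h n \<in> S"
  using assms(5-)
proof (induction I arbitrary: h n rule: finite_induct)
  case empty
  then show ?case by simp
next
  case (insert k I)
  note S' = left_idealD[OF S]
  have T0: "T 0 = 0"
    using T_add[of 0 0] by simp
  have T_sum: "T (sum g A) = (\<Sum>n\<in>A. T (g n))" for g :: "'i \<Rightarrow> 'a" and A
    by (induction A rule: infinite_finite_induct) (simp_all add: T0 T_add)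
  have scale_sum: "c \<bullet> sum g A = (\<Sum>n\<in>A. c \<bullet> g n)" for c and g :: "'i \<Rightarrow> 'a" and A
    by (induction A rule: infinite_finite_induct) (simp_all add: scale_add_right)
  have sum_in: "sum g A \<in> S" if "\<And>n. n \<in> A \<Longrightarrow> g n \<in> S" for g :: "'i \<Rightarrow> 'a" and A
    using that by (induction A rule: infinite_finite_induct) (auto intro: S')
  have T_diff: "T (x - y) = T x - T y" for x y
    using T_add[of "x - y" y] by simp
  \<comment> \<open>the components of \<open>T x - l k \<bullet> x\<close>, where \<open>x\<close> is the given sum\<close>
  let ?g = "\<lambda>n. (l n - l k) \<bullet> h n"
  have "(\<Sum>n\<in>I. ?g n) =
      T (sum h (insert k I)) - l k \<bullet> sum h (insert k I)
        - (\<Sum>n\<in>insert k I. T (h n) - l n \<bullet> h n)"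
    using insert.hyps
    by (simp add: T_add T_sum scale_add_right scale_sum sum_subtractf scale_diff_left)
  also have "\<dots> \<in> S"
    by (intro S'(7) T_S S'(5) sum_in insert.prems)
  finally have sum_g: "sum ?g I \<in> S" .
  have "?g n \<in> S" if "n \<in> I" for n
  proof (rule insert.IH[OF _ _ sum_g that])
    show "inj_on l I"
      using insert.prems(1) by (auto simp: inj_on_def)
    show "T (?g n) - l n \<bullet> ?g n \<in> S" if "n \<in> I" for n
      using S'(5)[OF insert.prems(2)[of n], of "l n - l k"] that
      by (simp add: T_scale scale_diff_right mult.commute)
  qed
  then have I: "h n \<in> S" if "n \<in> I" for n
  proof -
    have "l n \<noteq> l k"
      using insert.prems(1) insert.hyps(2) that by (auto simp: inj_on_def)
    then show ?thesis
      using S'(5)[OF \<open>\<And>n. n \<in> I \<Longrightarrow> ?g n \<in> S\<close>[OF that], of "inverse (l n - l k)"] by simp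
  qed
  have "h k = sum h (insert k I) - sum h I"
    using insert.hyps by simp
  then have "h k \<in> S"
    using S'(7)[OF insert.prems(3) sum_in[of I h]] I by simp
  then show ?case
    using I insert.prems(4) by blast
qed

end

section \<open>Powers of \<open>K\<close>, the centre and the Casimir element\<close>

text \<open>
  \<open>L\<close> stands for the inverse of \<open>K\<close>.  The assumption \<open>generated\<close> is the induction principle expressing
  that the four generators generate the algebra.
\<close>
locale Uq_relations = algebra_mod_ideal J scale
  for J :: "'a::ring_1 set" and scale :: "complex \<Rightarrow> 'a \<Rightarrow> 'a" (infixr \<open>\<bullet>\<close> 75) +
  fixes E F K L :: 'a and q :: complex and m :: nat
  assumes q_nonzero: "q \<noteq> 0"
    and q_not_root_of_unity: "n \<ge> 1 \<Longrightarrow> q ^ n \<noteq> 1"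
    and m_positive: "m \<ge> 1"
    and KE: "K * E \<asymp> q\<^sup>2 \<bullet> (E * K)"
    and KF: "K * F \<asymp> inverse (q\<^sup>2) \<bullet> (F * K)"
    and KL: "K * L \<asymp> 1"
    and LK: "L * K \<asymp> 1"
    and EF_FE: "E * F - F * E \<asymp> (1 / (q - inverse q)) \<bullet> (K ^ m - L ^ m)"
    and generated [consumes 0, case_names one add scale mult]:
      "P 1 \<Longrightarrow> (\<And>x y. P x \<Longrightarrow> P y \<Longrightarrow> P (x + y)) \<Longrightarrow> (\<And>c x. P x \<Longrightarrow> P (c \<bullet> x)) \<Longrightarrow>
       (\<And>g x. g \<in> {E, F, K, L} \<Longrightarrow> P x \<Longrightarrow> P (g * x)) \<Longrightarrow> P x"
begin

text \<open>
  The eigenvalue of conjugation by \<open>K\<close> on elements of weight \<open>n\<close>, where \<open>E\<close> has weight 1.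
\<close>
definition qpow :: "int \<Rightarrow> complex"
  where "qpow n = q powi (2 * n)"

lemma qpow_nonzero [simp]: "qpow n \<noteq> 0"
  by (simp add: qpow_def q_nonzero)

lemma qpow_0 [simp]: "qpow 0 = 1"
  by (simp add: qpow_def)

lemma qpow_add: "qpow (i + j) = qpow i * qpow j"
  by (simp add: qpow_def q_nonzero power_int_add distrib_left)

lemma qpow_1: "qpow 1 = q\<^sup>2"
  by (simp add: qpow_def)

lemma qpow_minus: "qpow (- n) = inverse (qpow n)"
  by (simp add: qpow_def power_int_minus)

lemma qpow_eq_1_iff: "qpow n = 1 \<longleftrightarrow> n = 0"
proof
  have pos: "qpow n \<noteq> 1" if "n > 0" for n
  proof -
    have "q powi (2 * n) = q ^ nat (2 * n)"
      using that by (simp add: power_int_def)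
    then show ?thesis
      using q_not_root_of_unity[of "nat (2 * n)"] that by (simp add: qpow_def)
  qed
  assume "qpow n = 1"
  then show "n = 0"
    using pos[of n] pos[of "- n"] qpow_minus[of n] by fastforce
qed simp

lemma inj_qpow: "inj qpow"
proof (rule injI)
  fix i j assume "qpow i = qpow j"
  then have "qpow (i - j) = 1"
    using qpow_add[of "i - j" j] by simp
  then show "i = j"
    by (simp add: qpow_eq_1_iff)
qed

definition Kpow :: "int \<Rightarrow> 'a"
  where "Kpow j = (if j \<ge> 0 then K ^ nat j else L ^ nat (- j))"

lemma Kpow_simps [simp]: "Kpow 0 = 1" "Kpow 1 = K" "Kpow (- 1) = L"
  "Kpow (int n) = K ^ n" "Kpow (- int n) = L ^ n"
  by (simp_all add: Kpow_def)

lemma K_Kpow: "K * Kpow j \<asymp> Kpow (j + 1)"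
proof (cases "j \<ge> 0")
  case True
  then have "nat (j + 1) = Suc (nat j)" by simp
  with True show ?thesis by (simp add: Kpow_def)
next
  case False
  then have "nat (- j) = Suc (nat (- (j + 1)))" by simp
  with False have *: "Kpow j = L * L ^ nat (- (j + 1))" "Kpow (j + 1) = 1 * L ^ nat (- (j + 1))"
    by (auto simp: Kpow_def)
  show ?thesis
    unfolding * mult.assoc[symmetric] by (intro cong_right KL)
qed

lemma L_Kpow: "L * Kpow j \<asymp> Kpow (j - 1)"
proof (cases "j \<le> 0")
  case True
  then have "nat (- (j - 1)) = Suc (nat (- j))" by simp
  with True show ?thesis by (auto simp add: Kpow_def)
next
  case False
  then have "nat j = Suc (nat (j - 1))" by simp
  with False have *: "Kpow j = K * K ^ nat (j - 1)" "Kpow (j - 1) = 1 * K ^ nat (j - 1)"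
    by (auto simp: Kpow_def)
  show ?thesis
    unfolding * mult.assoc[symmetric] by (intro cong_right LK)
qed

lemma Kpow_add: "Kpow i * Kpow j \<asymp> Kpow (i + j)"
proof (induction i rule: int_induct[of _ 0])
  case base
  then show ?case by simp
next
  case (step1 i)
  have "Kpow (i + 1) * Kpow j \<asymp> K * Kpow i * Kpow j"
    by (intro cong_right cong_sym[OF K_Kpow])
  also have "\<dots> \<asymp> K * Kpow (i + j)"
    using step1 by (simp add: mult.assoc cong_left)
  also have "\<dots> \<asymp> Kpow (i + j + 1)"
    by (rule K_Kpow)
  finally show ?case by (simp add: algebra_simps)
next
  case (step2 i)
  have "Kpow (i - 1) * Kpow j \<asymp> L * Kpow i * Kpow j"
    by (intro cong_right cong_sym[OF L_Kpow])
  also have "\<dots> \<asymp> L * Kpow (i + j)"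
    using step2 by (simp add: mult.assoc cong_left)
  also have "\<dots> \<asymp> Kpow (i + j - 1)"
    by (rule L_Kpow)
  finally show ?case by (simp add: algebra_simps)
qed

lemma Kpow_commute: "Kpow i * Kpow j \<asymp> Kpow j * Kpow i"
  using cong_trans[OF Kpow_add cong_sym[OF Kpow_add[of j i, unfolded add.commute[of j]]]] .

text \<open>
  The elements of weight \<open>n\<close> under conjugation by \<open>K\<close>, written without the inverse of \<open>K\<close>.
\<close>
definition twisted :: "int \<Rightarrow> 'a \<Rightarrow> bool"
  where "twisted n x \<longleftrightarrow> K * x \<asymp> qpow n \<bullet> (x * K)"

lemma twisted_E: "twisted 1 E" and twisted_F: "twisted (- 1) F"
  using KE KF by (simp_all add: twisted_def qpow_minus qpow_1)

lemma twisted_mult: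
  assumes "twisted i x" "twisted j y"
  shows "twisted (i + j) (x * y)"
proof -
  have "K * (x * y) \<asymp> qpow i \<bullet> (x * K) * y"
    using assms(1) unfolding twisted_def mult.assoc[symmetric] by (rule cong_right)
  also have "qpow i \<bullet> (x * K) * y = qpow i \<bullet> x * (K * y)"
    by (simp add: mult.assoc)
  also have "\<dots> \<asymp> qpow i \<bullet> x * (qpow j \<bullet> (y * K))"
    using assms(2) unfolding twisted_def by (intro cong_scale cong_left)
  also have "\<dots> = qpow (i + j) \<bullet> (x * y * K)"
    by (simp add: mult.assoc qpow_add mult.commute[of "qpow i"])
  finally show ?thesis
    by (simp add: twisted_def)
qed

lemma twisted_one: "twisted 0 1"
  by (simp add: twisted_def)

text \<open>
  It suffices to move \<open>x\<close> past \<open>K\<close> and past \<open>L\<close>; the rule for \<open>L\<close> follows by multiplying the one for \<open>K\<close>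
  by \<open>L\<close> on both sides.
\<close>
lemma twisted_Kpow:
  assumes "twisted n x"
  shows "x * Kpow j \<asymp> qpow (- n * j) \<bullet> (Kpow j * x)"
proof -
  have xK: "x * K \<asymp> qpow (- n) \<bullet> (K * x)"
    using cong_scale[OF assms[unfolded twisted_def], of "qpow (- n)"]
    by (auto simp: qpow_minus intro: cong_sym)
  have "x * L = 1 * (x * L)" by simp
  also have "\<dots> \<asymp> L * K * (x * L)"
    by (intro cong_right cong_sym[OF LK])
  also have "\<dots> = L * (K * x) * L"
    by (simp add: mult.assoc)
  also have "\<dots> \<asymp> L * (qpow n \<bullet> (x * K)) * L"
    using assms unfolding twisted_def by (intro cong_right cong_left)
  also have "\<dots> = qpow n \<bullet> (L * x) * (K * L)"
    by (simp add: mult.assoc)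
  also have "\<dots> \<asymp> qpow n \<bullet> (L * x) * 1"
    by (intro cong_left cong_scale KL)
  finally have xL: "x * L \<asymp> qpow n \<bullet> (L * x)"
    by simp
  show ?thesis
  proof (induction j rule: int_induct[of _ 0])
    case base
    then show ?case by simp
  next
    case (step1 j)
    have "x * Kpow (j + 1) \<asymp> x * K * Kpow j"
      unfolding mult.assoc by (intro cong_left cong_sym[OF K_Kpow])
    also have "\<dots> \<asymp> qpow (- n) \<bullet> (K * x) * Kpow j"
      by (intro cong_right xK)
    also have "\<dots> = qpow (- n) \<bullet> K * (x * Kpow j)"
      by (simp add: mult.assoc)
    also have "\<dots> \<asymp> qpow (- n) \<bullet> K * (qpow (- n * j) \<bullet> (Kpow j * x))"
      by (intro cong_left cong_scale step1)
    also have "\<dots> = qpow (- n * (j + 1)) \<bullet> ((K * Kpow j) * x)"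
      by (simp add: mult.assoc distrib_left qpow_add[symmetric] add.commute)
    also have "\<dots> \<asymp> qpow (- n * (j + 1)) \<bullet> (Kpow (j + 1) * x)"
      by (intro cong_scale cong_right K_Kpow)
    finally show ?case .
  next
    case (step2 j)
    have "x * Kpow (j - 1) \<asymp> x * L * Kpow j"
      unfolding mult.assoc by (intro cong_left cong_sym[OF L_Kpow])
    also have "\<dots> \<asymp> qpow n \<bullet> (L * x) * Kpow j"
      by (intro cong_right xL)
    also have "\<dots> = qpow n \<bullet> L * (x * Kpow j)"
      by (simp add: mult.assoc)
    also have "\<dots> \<asymp> qpow n \<bullet> L * (qpow (- n * j) \<bullet> (Kpow j * x))"
      by (intro cong_left cong_scale step2)
    also have "\<dots> = qpow (- n * (j - 1)) \<bullet> ((L * Kpow j) * x)"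
      by (simp add: mult.assoc right_diff_distrib qpow_add[symmetric] add.commute)
    also have "\<dots> \<asymp> qpow (- n * (j - 1)) \<bullet> (Kpow (j - 1) * x)"
      by (intro cong_scale cong_right L_Kpow)
    finally show ?case .
  qed
qed

text \<open>
  The preimage of the centre of the quotient by \<open>J\<close>.
\<close>
definition centre :: "'a set"
  where "centre = {z. \<forall>x. z * x \<asymp> x * z}"

lemma centreD: "z \<in> centre \<Longrightarrow> z * x \<asymp> x * z"
  by (simp add: centre_def)

lemma centre_one: "1 \<in> centre"
  by (simp add: centre_def)

lemma centre_J: "x \<in> J \<Longrightarrow> x \<in> centre"
  by (simp add: centre_def cong_def J_diff J_left J_right)

lemma centre_add: "x \<in> centre \<Longrightarrow> y \<in> centre \<Longrightarrow> x + y \<in> centre"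
  by (simp add: centre_def distrib_left distrib_right cong_add)

lemma centre_scale: "x \<in> centre \<Longrightarrow> c \<bullet> x \<in> centre"
  by (simp add: centre_def cong_scale)

lemma centre_mult:
  assumes "x \<in> centre" "y \<in> centre"
  shows "x * y \<in> centre"
  unfolding centre_def
proof (intro CollectI allI)
  fix u
  have "x * y * u \<asymp> x * (u * y)"
    unfolding mult.assoc by (intro cong_left centreD assms)
  also have "\<dots> \<asymp> u * x * y"
    unfolding mult.assoc[symmetric] by (intro cong_right centreD assms)
  finally show "x * y * u \<asymp> u * (x * y)"
    by (simp add: mult.assoc)
qed

lemma centreI:
  assumes "z * E \<asymp> E * z" "z * F \<asymp> F * z" "z * K \<asymp> K * z"
  shows "z \<in> centre"
proof -
  have "twisted 0 z"
    using assms(3) by (simp add: twisted_def cong_sym)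
  from twisted_Kpow[OF this, of "- 1"] have "z * L \<asymp> L * z"
    by simp
  with assms have gen: "z * g \<asymp> g * z" if "g \<in> {E, F, K, L}" for g
    using that by auto
  have "z * x \<asymp> x * z" for x
  proof (induction x rule: generated)
    case one
    then show ?case by simp
  next
    case (add x y)
    then show ?case by (simp add: distrib_left distrib_right cong_add)
  next
    case (scale c x)
    then show ?case by (simp add: cong_scale)
  next
    case (mult g x)
    have "z * (g * x) \<asymp> g * z * x"
      unfolding mult.assoc[symmetric] by (intro cong_right gen mult)
    also have "\<dots> \<asymp> g * (x * z)"
      unfolding mult.assoc by (intro cong_left mult)
    finally show ?case by (simp add: mult.assoc)
  qed
  then show ?thesis by (simp add: centre_def)
qed

text \<open>
  The coefficients are determined by requiring that \<open>casimir\<close> commute with \<open>E\<close>: moving \<open>E\<close> past \<open>F * E\<close>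
  produces the commutator \<open>E * F - F * E\<close>, a combination of \<open>K\<^sup>m\<close> and \<open>K\<^sup>-\<^sup>m\<close>, while moving \<open>E\<close> past
  \<open>K\<^sup>m\<close> and \<open>K\<^sup>-\<^sup>m\<close> multiplies them by \<open>q\<^sup>-\<^sup>2\<^sup>m\<close> and \<open>q\<^sup>2\<^sup>m\<close>.  Both denominators are nonzero since
  \<open>q\<close> is not a root of unity.
\<close>
definition cas_pos :: complex
  where "cas_pos = 1 / ((q - inverse q) * (1 - qpow (- int m)))"

definition cas_neg :: complex
  where "cas_neg = 1 / ((q - inverse q) * (qpow (int m) - 1))"

definition casimir :: 'a
  where "casimir = F * E + cas_pos \<bullet> Kpow (int m) + cas_neg \<bullet> Kpow (- int m)"

lemma q_minus_inverse: "q - inverse q \<noteq> 0"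
proof
  assume "q - inverse q = 0"
  then have "q ^ 2 = 1"
    using q_nonzero by (simp add: power2_eq_square field_simps)
  then show False
    using q_not_root_of_unity[of 2] by simp
qed

lemma cas_pos: "cas_pos \<noteq> 0" "cas_pos * (1 - qpow (- int m)) = 1 / (q - inverse q)"
  using q_minus_inverse qpow_eq_1_iff[of "- int m"] m_positive
  by (simp_all add: cas_pos_def)

lemma cas_neg: "cas_neg * (qpow (int m) - 1) = 1 / (q - inverse q)"
  using q_minus_inverse qpow_eq_1_iff[of "int m"] m_positive
  by (simp add: cas_neg_def)

lemma EF_cong: "E * F \<asymp> F * E + (1 / (q - inverse q)) \<bullet> (Kpow (int m) - Kpow (- int m))"
  using EF_FE by (simp add: cong_def algebra_simps)

text \<open>
  The four correction terms that arise when \<open>casimir\<close> passes \<open>E\<close> or \<open>F\<close> cancel by the choice of the two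
  coefficients; \<open>K\<close> commutes with \<open>F * E\<close>, which has weight 0.
\<close>
lemma casimir_central: "casimir \<in> centre"
proof (rule centreI)
  let ?P = "Kpow (int m)" and ?N = "Kpow (- int m)" and ?k = "1 / (q - inverse q)"
  have P: "E * ?P \<asymp> qpow (- int m) \<bullet> (?P * E)" "F * ?P \<asymp> qpow (int m) \<bullet> (?P * F)"
    and N: "E * ?N \<asymp> qpow (int m) \<bullet> (?N * E)" "F * ?N \<asymp> qpow (- int m) \<bullet> (?N * F)"
    using twisted_Kpow[OF twisted_E, of "int m"] twisted_Kpow[OF twisted_F, of "int m"]
      twisted_Kpow[OF twisted_E, of "- int m"] twisted_Kpow[OF twisted_F, of "- int m"]
    by simp_all
  have pos: "cas_pos = ?k + cas_pos * qpow (- int m)"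
    and neg: "cas_neg = - ?k + cas_neg * qpow (int m)"
    using cas_pos cas_neg by (simp_all add: algebra_simps)
  have "E * casimir = E * F * E + cas_pos \<bullet> (E * ?P) + cas_neg \<bullet> (E * ?N)"
    by (simp add: casimir_def distrib_left mult.assoc)
  also have "\<dots> \<asymp> (F * E + ?k \<bullet> (?P - ?N)) * E + cas_pos \<bullet> (qpow (- int m) \<bullet> (?P * E))
      + cas_neg \<bullet> (qpow (int m) \<bullet> (?N * E))"
    by (intro cong_add cong_scale P N cong_right EF_cong)
  also have "\<dots> = F * E * E + (?k + cas_pos * qpow (- int m)) \<bullet> (?P * E)
      + (- ?k + cas_neg * qpow (int m)) \<bullet> (?N * E)"
    by (simp add: scale_add_left scale_diff_left distrib_right left_diff_distrib scale_diff_right)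
  also have "\<dots> = casimir * E"
    unfolding pos[symmetric] neg[symmetric] by (simp add: casimir_def distrib_right)
  finally show "casimir * E \<asymp> E * casimir"
    by (rule cong_sym)
  \<comment> \<open>the same two identities, multiplied by \<open>q\<^sup>2\<^sup>m\<close> and \<open>q\<^sup>-\<^sup>2\<^sup>m\<close>\<close>
  have pos': "cas_pos * qpow (int m) = ?k * qpow (int m) + cas_pos"
    and neg': "cas_neg * qpow (- int m) = - ?k * qpow (- int m) + cas_neg"
    using arg_cong[OF cas_pos(2), of "\<lambda>x. x * qpow (int m)"]
      arg_cong[OF cas_neg, of "\<lambda>x. x * qpow (- int m)"]
    by (simp_all add: algebra_simps qpow_minus)
  have "casimir * F = F * (E * F) + cas_pos \<bullet> (?P * F) + cas_neg \<bullet> (?N * F)"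
    by (simp add: casimir_def distrib_right mult.assoc)
  also have "\<dots> \<asymp> F * (F * E + ?k \<bullet> (?P - ?N)) + cas_pos \<bullet> (?P * F) + cas_neg \<bullet> (?N * F)"
    by (intro cong_add cong_refl cong_left EF_cong)
  also have "\<dots> = F * F * E + ?k \<bullet> (F * ?P) - ?k \<bullet> (F * ?N)
      + cas_pos \<bullet> (?P * F) + cas_neg \<bullet> (?N * F)"
    by (simp add: distrib_left right_diff_distrib scale_diff_right mult.assoc)
  also have "\<dots> \<asymp> F * F * E + ?k \<bullet> qpow (int m) \<bullet> (?P * F) - ?k \<bullet> qpow (- int m) \<bullet> (?N * F)
      + cas_pos \<bullet> (?P * F) + cas_neg \<bullet> (?N * F)"
    by (intro cong_add cong_diff cong_refl cong_scale P N)
  also have "\<dots> = F * F * E + (?k * qpow (int m) + cas_pos) \<bullet> (?P * F)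
      + (- ?k * qpow (- int m) + cas_neg) \<bullet> (?N * F)"
    by (simp add: scale_add_left scale_diff_left)
  also have "\<dots> = F * F * E + cas_pos \<bullet> qpow (int m) \<bullet> (?P * F)
      + cas_neg \<bullet> qpow (- int m) \<bullet> (?N * F)"
    unfolding pos'[symmetric] neg'[symmetric] by simp
  also have "\<dots> \<asymp> F * F * E + cas_pos \<bullet> (F * ?P) + cas_neg \<bullet> (F * ?N)"
    by (intro cong_add cong_refl cong_scale P[THEN cong_sym] N[THEN cong_sym])
  also have "\<dots> = F * casimir"
    by (simp add: casimir_def distrib_left mult.assoc)
  finally show "casimir * F \<asymp> F * casimir" .
  have "K * (F * E) \<asymp> F * E * K"
    using twisted_mult[OF twisted_F twisted_E] by (simp add: twisted_def)
  moreover have "K * Kpow j \<asymp> Kpow j * K" for j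
    using Kpow_commute[of 1 j] by simp
  ultimately have "K * (F * E) + cas_pos \<bullet> (K * ?P) + cas_neg \<bullet> (K * ?N) \<asymp>
      F * E * K + cas_pos \<bullet> (?P * K) + cas_neg \<bullet> (?N * K)"
    by (intro cong_add cong_scale)
  then have "K * casimir \<asymp> casimir * K"
    by (simp add: casimir_def distrib_left distrib_right)
  then show "casimir * K \<asymp> K * casimir"
    by (rule cong_sym)
qed

section \<open>The degree-zero subalgebra\<close>

text \<open>
  The coefficients of the powers of \<open>K\<close> range over the whole centre.  With this choice, every
  coefficient that is later found to annihilate the Whittaker vector is central by construction, and
  the elements \<open>F * E\<close> and \<open>E * F\<close> still lie in \<open>degree_zero\<close> because they differ from the Casimir element
  by combinations of powers of \<open>K\<close>.
\<close>
definition torus_part :: "int \<Rightarrow> 'a set"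
  where "torus_part j = {x. \<exists>z\<in>centre. x \<asymp> Kpow j * z}"

definition degree_zero :: "'a set"
  where "degree_zero = graded_sum torus_part"

lemma torus_partI: "z \<in> centre \<Longrightarrow> x \<asymp> Kpow j * z \<Longrightarrow> x \<in> torus_part j"
  by (auto simp: torus_part_def)

lemma torus_part_zero: "0 \<in> torus_part j"
  by (rule torus_partI[OF centre_J[OF J_zero]]) simp

lemma torus_part_add:
  assumes "x \<in> torus_part j" "y \<in> torus_part j"
  shows "x + y \<in> torus_part j"
proof -
  from assms obtain w z where "w \<in> centre" "x \<asymp> Kpow j * w" "z \<in> centre" "y \<asymp> Kpow j * z"
    by (auto simp: torus_part_def)
  then show ?thesis
    by (intro torus_partI[of "w + z"] centre_add) (simp_all add: distrib_left cong_add)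
qed

lemma torus_part_scale:
  assumes "x \<in> torus_part j"
  shows "c \<bullet> x \<in> torus_part j"
proof -
  from assms obtain w where "w \<in> centre" "x \<asymp> Kpow j * w"
    by (auto simp: torus_part_def)
  then show ?thesis
    by (intro torus_partI[of "c \<bullet> w"] centre_scale) (simp_all add: cong_scale)
qed

lemma torus_part_diff:
  "x \<in> torus_part j \<Longrightarrow> y \<in> torus_part j \<Longrightarrow> x - y \<in> torus_part j"
  using torus_part_add[of x j "- 1 \<bullet> y"] torus_part_scale[of y j "- 1"]
  by (simp add: scale_minus_left)

lemma torus_part_mult:
  assumes "x \<in> torus_part i" "y \<in> torus_part j"
  shows "x * y \<in> torus_part (i + j)"
proof -
  from assms obtain w z where wz: "w \<in> centre" "x \<asymp> Kpow i * w" "z \<in> centre" "y \<asymp> Kpow j * z"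
    by (auto simp: torus_part_def)
  have "x * y \<asymp> Kpow i * w * y"
    by (intro cong_right wz)
  also have "\<dots> \<asymp> Kpow i * w * (Kpow j * z)"
    by (intro cong_left wz)
  also have "\<dots> = Kpow i * (w * Kpow j) * z"
    by (simp add: mult.assoc)
  also have "\<dots> \<asymp> Kpow i * (Kpow j * w) * z"
    by (intro cong_right cong_left centreD wz)
  also have "\<dots> = Kpow i * Kpow j * (w * z)"
    by (simp add: mult.assoc)
  also have "\<dots> \<asymp> Kpow (i + j) * (w * z)"
    by (intro cong_right Kpow_add)
  finally show ?thesis
    by (intro torus_partI[of "w * z"] centre_mult wz)
qed

lemma torus_part_commute:
  assumes "x \<in> torus_part i" "y \<in> torus_part j"
  shows "x * y \<asymp> y * x"
proof -
  from assms obtain w z where wz: "w \<in> centre" "x \<asymp> Kpow i * w" "z \<in> centre" "y \<asymp> Kpow j * z"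
    by (auto simp: torus_part_def)
  have xK: "x * Kpow j \<asymp> Kpow j * x"
  proof -
    have "x * Kpow j \<asymp> Kpow i * (w * Kpow j)"
      unfolding mult.assoc[symmetric] by (intro cong_right wz)
    also have "\<dots> \<asymp> Kpow i * Kpow j * w"
      unfolding mult.assoc by (intro cong_left centreD wz)
    also have "\<dots> \<asymp> Kpow j * Kpow i * w"
      by (intro cong_right Kpow_commute)
    also have "\<dots> \<asymp> Kpow j * x"
      unfolding mult.assoc by (intro cong_left cong_sym[OF wz(2)])
    finally show ?thesis .
  qed
  have "x * y \<asymp> x * Kpow j * z"
    unfolding mult.assoc by (intro cong_left wz)
  also have "\<dots> \<asymp> Kpow j * (x * z)"
    unfolding mult.assoc[symmetric] by (intro cong_right xK)
  also have "\<dots> \<asymp> Kpow j * z * x"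
    unfolding mult.assoc by (intro cong_left cong_sym[OF centreD] wz)
  also have "\<dots> \<asymp> y * x"
    by (intro cong_right cong_sym[OF wz(4)])
  finally show ?thesis .
qed

lemma torus_part_in_degree_zero: "x \<in> torus_part j \<Longrightarrow> x \<in> degree_zero"
  unfolding degree_zero_def by (rule graded_sum_component[OF torus_part_zero])

lemma degree_zero_add: "x \<in> degree_zero \<Longrightarrow> y \<in> degree_zero \<Longrightarrow> x + y \<in> degree_zero"
  unfolding degree_zero_def by (rule graded_sum_add[OF torus_part_add])

lemma degree_zero_induct [consumes 1, case_names component add]:
  assumes "x \<in> degree_zero" and "\<And>j x. x \<in> torus_part j \<Longrightarrow> P x"
    and "\<And>x y. P x \<Longrightarrow> P y \<Longrightarrow> P (x + y)"
  shows "P x"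
  using assms(1) unfolding degree_zero_def
  by (induction rule: graded_sum_induct) (use assms torus_part_zero in blast)+

lemma centre_in_degree_zero: "z \<in> centre \<Longrightarrow> z \<in> degree_zero"
  by (rule torus_part_in_degree_zero[of _ 0]) (auto intro: torus_partI)

lemma Kpow_in_torus_part: "Kpow j \<in> torus_part j"
  by (rule torus_partI[OF centre_one]) simp

lemmas Kpow_in_degree_zero = torus_part_in_degree_zero[OF Kpow_in_torus_part]

lemma degree_zero_cong:
  assumes "x \<asymp> y" "y \<in> degree_zero"
  shows "x \<in> degree_zero"
proof -
  have "x - y \<in> degree_zero"
    using assms(1) by (intro centre_in_degree_zero centre_J) (simp add: cong_def)
  from degree_zero_add[OF this assms(2)] show ?thesis by simp
qed

lemma degree_zero_scale:
  assumes "x \<in> degree_zero"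
  shows "c \<bullet> x \<in> degree_zero"
  using assms
  by (induction rule: degree_zero_induct)
    (auto simp: scale_add_right intro: degree_zero_add torus_part_in_degree_zero torus_part_scale)

lemma degree_zero_diff:
  "x \<in> degree_zero \<Longrightarrow> y \<in> degree_zero \<Longrightarrow> x - y \<in> degree_zero"
  using degree_zero_add[of x "- 1 \<bullet> y"] degree_zero_scale[of y "- 1"]
  by (simp add: scale_minus_left)

lemma degree_zero_mult:
  assumes "x \<in> degree_zero" "y \<in> degree_zero"
  shows "x * y \<in> degree_zero"
  using assms(1)
proof (induction rule: degree_zero_induct)
  case (component i x)
  show ?case
    using assms(2)
    by (induction rule: degree_zero_induct)
      (auto simp: distrib_left
        intro: degree_zero_add torus_part_in_degree_zero torus_part_mult component)
next
  case (add x x')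
  then show ?case by (simp add: distrib_right degree_zero_add)
qed

lemma degree_zero_commute:
  assumes "x \<in> degree_zero" "y \<in> degree_zero"
  shows "x * y \<asymp> y * x"
  using assms(1)
proof (induction rule: degree_zero_induct)
  case (component i x)
  show ?case
    using assms(2)
    by (induction rule: degree_zero_induct)
      (auto simp: distrib_left distrib_right intro: cong_add torus_part_commute component)
next
  case (add x x')
  then show ?case by (simp add: distrib_left distrib_right cong_add)
qed

text \<open>
  Passing an element of weight \<open>n\<close> rescales each \<open>K\<^sup>j\<close> by a power of \<open>q\<close> and leaves the central
  coefficients alone.
\<close>
lemma degree_zero_move_left:
  assumes "twisted n g" "d \<in> degree_zero"
  obtains d' where "d' \<in> degree_zero" "g * d \<asymp> d' * g"
proof -
  have "\<exists>d'\<in>degree_zero. g * d \<asymp> d' * g"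
    using assms(2)
  proof (induction rule: degree_zero_induct)
    case (component j x)
    then obtain z where z: "z \<in> centre" "x \<asymp> Kpow j * z"
      by (auto simp: torus_part_def)
    have "g * x \<asymp> g * Kpow j * z"
      unfolding mult.assoc by (intro cong_left z)
    also have "\<dots> \<asymp> qpow (- n * j) \<bullet> (Kpow j * g) * z"
      by (intro cong_right twisted_Kpow assms)
    also have "\<dots> = qpow (- n * j) \<bullet> Kpow j * (g * z)"
      by (simp add: mult.assoc)
    also have "\<dots> \<asymp> qpow (- n * j) \<bullet> Kpow j * (z * g)"
      by (intro cong_scale cong_left cong_sym[OF centreD] z)
    also have "\<dots> = (qpow (- n * j) \<bullet> (Kpow j * z)) * g"
      by (simp add: mult.assoc)
    finally show ?case
      by (intro bexI[of _ "qpow (- n * j) \<bullet> (Kpow j * z)"])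
        (auto intro: degree_zero_scale degree_zero_mult Kpow_in_degree_zero centre_in_degree_zero z)
  next
    case (add x y)
    then obtain x' y' where "x' \<in> degree_zero" "g * x \<asymp> x' * g" "y' \<in> degree_zero" "g * y \<asymp> y' * g"
      by blast
    then show ?case
      by (intro bexI[of _ "x' + y'"]) (auto simp: distrib_left distrib_right intro: cong_add degree_zero_add)
  qed
  with that show thesis by blast
qed

lemma FE_eq: "F * E = casimir - cas_pos \<bullet> Kpow (int m) - cas_neg \<bullet> Kpow (- int m)"
  by (simp add: casimir_def)

lemma FE_in_degree_zero: "F * E \<in> degree_zero"
  unfolding FE_eq
  by (intro degree_zero_diff degree_zero_scale centre_in_degree_zero casimir_central Kpow_in_degree_zero)

lemma EF_in_degree_zero: "E * F \<in> degree_zero"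
  by (rule degree_zero_cong[OF EF_cong])
    (intro degree_zero_diff degree_zero_scale degree_zero_add FE_in_degree_zero Kpow_in_degree_zero)


section \<open>The grading by conjugation with \<open>K\<close>\<close>

text \<open>
  Because \<open>E * F\<close> and \<open>F * E\<close> lie in \<open>degree_zero\<close>, a power of a single generator suffices in each weight.
\<close>
definition EFpow :: "int \<Rightarrow> 'a"
  where "EFpow n = (if n \<ge> 0 then E ^ nat n else F ^ nat (- n))"

lemma EFpow_simps [simp]: "EFpow 0 = 1" "EFpow (int k) = E ^ k" "EFpow (- int k) = F ^ k"
  by (simp_all add: EFpow_def)

lemma twisted_F_power: "twisted (- int k) (F ^ k)"
proof (induction k)
  case (Suc k)
  then show ?case using twisted_mult[OF twisted_F Suc] by simp
qed (simp add: twisted_one)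

lemma twisted_E_power: "twisted (int k) (E ^ k)"
proof (induction k)
  case (Suc k)
  then show ?case using twisted_mult[OF twisted_E Suc] by simp
qed (simp add: twisted_one)

lemma twisted_EFpow: "twisted n (EFpow n)"
proof (cases n rule: int_cases2)
  case (nonneg k)
  then show ?thesis by (simp add: twisted_E_power)
next
  case (nonpos k)
  then show ?thesis by (simp add: twisted_F_power)
qed

definition weight_part :: "int \<Rightarrow> 'a set"
  where "weight_part n = {x. \<exists>d\<in>degree_zero. x \<asymp> d * EFpow n}"

lemma weight_partI: "d \<in> degree_zero \<Longrightarrow> x \<asymp> d * EFpow n \<Longrightarrow> x \<in> weight_part n"
  by (auto simp: weight_part_def)

lemma zero_in_degree_zero: "0 \<in> degree_zero"
  by (rule torus_part_in_degree_zero[OF torus_part_zero])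

lemma weight_part_zero: "0 \<in> weight_part n"
  by (rule weight_partI[OF zero_in_degree_zero]) simp

lemma weight_part_add:
  assumes "x \<in> weight_part n" "y \<in> weight_part n"
  shows "x + y \<in> weight_part n"
proof -
  from assms obtain c d where "c \<in> degree_zero" "x \<asymp> c * EFpow n" "d \<in> degree_zero" "y \<asymp> d * EFpow n"
    by (auto simp: weight_part_def)
  then show ?thesis
    by (intro weight_partI[of "c + d"] degree_zero_add) (simp_all add: distrib_right cong_add)
qed

lemma weight_part_degree_zero_mult:
  assumes "c \<in> degree_zero" "x \<in> weight_part n"
  shows "c * x \<in> weight_part n"
proof -
  from assms obtain d where "d \<in> degree_zero" "x \<asymp> d * EFpow n"
    by (auto simp: weight_part_def)
  then show ?thesis
    using assms(1)
    by (intro weight_partI[of "c * d"] degree_zero_mult) (simp_all add: mult.assoc cong_left)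
qed

text \<open>
  Multiplying \<open>E\<close> into a power of \<open>F\<close> produces a factor \<open>E * F\<close>, which is absorbed by the coefficient.
\<close>
lemma weight_part_E_mult:
  assumes "x \<in> weight_part n"
  shows "E * x \<in> weight_part (n + 1)"
proof -
  from assms obtain d where d: "d \<in> degree_zero" "x \<asymp> d * EFpow n"
    by (auto simp: weight_part_def)
  obtain d' where d': "d' \<in> degree_zero" "E * d \<asymp> d' * E"
    using degree_zero_move_left[OF twisted_E d(1)] .
  have "E * x \<asymp> E * d * EFpow n"
    unfolding mult.assoc by (intro cong_left d)
  also have "\<dots> \<asymp> d' * E * EFpow n"
    by (intro cong_right d')
  finally have Ex: "E * x \<asymp> d' * (E * EFpow n)"
    by (simp add: mult.assoc)
  show ?thesis
  proof (cases "n \<ge> 0")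
    case True
    then have "nat (n + 1) = Suc (nat n)" by simp
    with True have "E * EFpow n = EFpow (n + 1)"
      by (simp add: EFpow_def)
    with Ex d' show ?thesis
      by (auto intro: weight_partI)
  next
    case False
    then have "nat (- n) = Suc (nat (- (n + 1)))" by simp
    with False have "EFpow n = F * EFpow (n + 1)"
      by (auto simp: EFpow_def)
    with Ex have "E * x \<asymp> d' * (E * F) * EFpow (n + 1)"
      by (simp add: mult.assoc)
    then show ?thesis
      by (rule weight_partI[rotated]) (intro degree_zero_mult d' EF_in_degree_zero)
  qed
qed

lemma weight_part_F_mult:
  assumes "x \<in> weight_part n"
  shows "F * x \<in> weight_part (n - 1)"
proof -
  from assms obtain d where d: "d \<in> degree_zero" "x \<asymp> d * EFpow n"
    by (auto simp: weight_part_def)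
  obtain d' where d': "d' \<in> degree_zero" "F * d \<asymp> d' * F"
    using degree_zero_move_left[OF twisted_F d(1)] .
  have "F * x \<asymp> F * d * EFpow n"
    unfolding mult.assoc by (intro cong_left d)
  also have "\<dots> \<asymp> d' * F * EFpow n"
    by (intro cong_right d')
  finally have Fx: "F * x \<asymp> d' * (F * EFpow n)"
    by (simp add: mult.assoc)
  show ?thesis
  proof (cases "n \<le> 0")
    case True
    then have "nat (- (n - 1)) = Suc (nat (- n))" by simp
    with True have "F * EFpow n = EFpow (n - 1)"
      by (auto simp: EFpow_def)
    with Fx d' show ?thesis
      by (auto intro: weight_partI)
  next
    case False
    then have "nat n = Suc (nat (n - 1))" by simp
    with False have "EFpow n = E * EFpow (n - 1)"
      by (auto simp: EFpow_def)
    with Fx have "F * x \<asymp> d' * (F * E) * EFpow (n - 1)"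
      by (simp add: mult.assoc)
    then show ?thesis
      by (rule weight_partI[rotated]) (intro degree_zero_mult d' FE_in_degree_zero)
  qed
qed

text \<open>
  The sum of the weight parts contains 1 and is stable under left multiplication by each generator,
  so it is the whole algebra.
\<close>
lemma graded_decomposition: "x \<in> graded_sum weight_part"
proof -
  note component = graded_sum_component[of weight_part, OF weight_part_zero]
  have sum_closed: "x + y \<in> graded_sum weight_part"
    if "x \<in> graded_sum weight_part" "y \<in> graded_sum weight_part" for x y
    using weight_part_add that by (rule graded_sum_add)
  have lift: "f x \<in> graded_sum weight_part"
    if "x \<in> graded_sum weight_part" "\<And>x y. f (x + y) = f x + f y"
      "\<And>n x. x \<in> weight_part n \<Longrightarrow> f x \<in> graded_sum weight_part" for f x
    using that(1)
  proof (induction rule: graded_sum_induct)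
    case zero
    then show ?case using that(3)[OF weight_part_zero] by simp
  next
    case (component n x)
    then show ?case by (rule that(3))
  next
    case (add x y)
    then show ?case by (simp add: that(2) sum_closed)
  qed
  show ?thesis
  proof (induction x rule: generated)
    case one
    show ?case
      by (rule component[of _ 0], rule weight_partI[OF centre_in_degree_zero[OF centre_one]]) simp
  next
    case (add x y)
    then show ?case by (rule sum_closed)
  next
    case (scale c x)
    then show ?case
    proof (rule lift)
      fix n x assume "x \<in> weight_part n"
      then have "(c \<bullet> 1) * x \<in> weight_part n"
        by (intro weight_part_degree_zero_mult centre_in_degree_zero centre_scale centre_one)
      then show "c \<bullet> x \<in> graded_sum weight_part"
        by (auto intro: component)
    qed (rule scale_add_right)
  next
    case (mult g x)
    from mult(2) show ?case
    proof (rule lift)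
      fix n x assume "x \<in> weight_part n"
      then show "g * x \<in> graded_sum weight_part"
        using mult(1) Kpow_in_degree_zero[of 1] Kpow_in_degree_zero[of "- 1"]
        by (auto intro: component weight_part_E_mult weight_part_F_mult weight_part_degree_zero_mult)
    qed (rule distrib_left)
  qed
qed

end

section \<open>The annihilator of a module generated by a Whittaker vector\<close>

text \<open>
  \<open>S\<close> plays the role of the left ideal of all elements killing a Whittaker vector \<open>w\<close> with \<open>E w = e w\<close>;
  this equation becomes the membership of \<open>E - e\<close> in \<open>S\<close>.
\<close>
locale whittaker_left_ideal = Uq_relations J scale E F K L q m
  for J :: "'a::ring_1 set" and scale :: "complex \<Rightarrow> 'a \<Rightarrow> 'a" (infixr \<open>\<bullet>\<close> 75)
    and E F K L :: 'a and q :: complex and m :: nat +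
  fixes S :: "'a set" and e :: complex
  assumes left_ideal_S: "left_ideal S"
    and E_minus_e: "E - e \<bullet> 1 \<in> S"
    and e_nonzero: "e \<noteq> 0"
begin

lemmas S_D = left_idealD[OF left_ideal_S]
lemmas S_cong = cong_in[OF left_ideal_S]

text \<open>
  Modulo \<open>S\<close>, the element \<open>x\<close> is an eigenvector of left multiplication by \<open>E\<close>: pass \<open>E\<close> to the right
  through \<open>K\<^sup>j\<close> and the central coefficient, and then replace it by \<open>e\<close>.
\<close>
lemma torus_part_eigen:
  assumes "x \<in> torus_part j"
  shows "E * x - (e * qpow (- j)) \<bullet> x \<in> S"
proof -
  obtain z where z: "z \<in> centre" "x \<asymp> Kpow j * z"
    using assms by (auto simp: torus_part_def)
  have "E * x \<asymp> E * Kpow j * z"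
    unfolding mult.assoc by (intro cong_left z)
  also have "\<dots> \<asymp> qpow (- j) \<bullet> (Kpow j * E) * z"
    using twisted_Kpow[OF twisted_E, of j] by (intro cong_right) simp
  also have "\<dots> = qpow (- j) \<bullet> Kpow j * (E * z)"
    by (simp add: mult.assoc)
  also have "\<dots> \<asymp> qpow (- j) \<bullet> Kpow j * (z * E)"
    by (intro cong_scale cong_left cong_sym[OF centreD] z)
  also have "\<dots> = qpow (- j) \<bullet> (Kpow j * z) * E"
    by (simp add: mult.assoc)
  also have "\<dots> \<asymp> qpow (- j) \<bullet> x * E"
    by (intro cong_scale cong_right cong_sym[OF z(2)])
  finally have "E * x - (e * qpow (- j)) \<bullet> x \<asymp> qpow (- j) \<bullet> x * E - (e * qpow (- j)) \<bullet> x"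
    by (rule cong_diff) simp
  also have "\<dots> = (qpow (- j) \<bullet> x) * (E - e \<bullet> 1)"
    by (simp add: right_diff_distrib scale_diff_right mult.commute)
  finally show ?thesis
    by (rule S_cong) (intro S_D(4) E_minus_e)
qed

text \<open>
  In the module, a sum of vectors \<open>K\<^sup>j z\<^sub>j w\<close> with central \<open>z\<^sub>j\<close> vanishes only if each of them does,
  because they lie in the eigenspaces of \<open>E\<close> for the distinct eigenvalues \<open>e q\<^sup>-\<^sup>2\<^sup>j\<close>.
\<close>
lemma torus_components_in:
  assumes "finite I" "\<And>j. h j \<in> torus_part j" "sum h I \<in> S" "j \<in> I"
  shows "h j \<in> S"
proof (rule eigencomponents_in[OF left_ideal_S, of "(*) E" I "\<lambda>j. e * qpow (- j)" h])
  show "inj_on (\<lambda>j. e * qpow (- j)) I"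
  proof (rule inj_onI)
    fix i j assume "e * qpow (- i) = e * qpow (- j)"
    then have "qpow (- i) = qpow (- j)"
      using e_nonzero by simp
    then show "i = j"
      using injD[OF inj_qpow] by fastforce
  qed
  show "E * h n - (e * qpow (- n)) \<bullet> h n \<in> S" for n
    by (intro torus_part_eigen assms)
qed (simp_all add: assms distrib_left S_D(4))

lemma torus_part_mult_right_in:
  assumes "x \<in> S" "x \<in> torus_part i" "y \<in> torus_part j"
  shows "x * y \<in> S"
  using torus_part_commute[OF assms(2,3)] by (rule S_cong) (intro S_D(4) assms)

text \<open>
  The factor on the right is a Laurent polynomial in \<open>K\<close> with central coefficients whose leading
  coefficient \<open>- a\<close> is an invertible scalar, so it is not a zero divisor modulo \<open>S\<close>.  If some component of
  \<open>d\<close> were not in \<open>S\<close>, take the one of largest degree \<open>k\<close>; the component of degree \<open>k + m\<close> of the product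
  is then, modulo \<open>S\<close>, a nonzero multiple of it.
\<close>
lemma degree_zero_cancel:
  assumes "d \<in> degree_zero" and "a \<noteq> 0"
    and dt: "d * (casimir - a \<bullet> Kpow (int m) - b \<bullet> Kpow (- int m)) \<in> S"
  shows "d \<in> S"
proof -
  obtain I h where h: "finite I" "\<And>j. h j \<in> torus_part j" "\<And>j. j \<notin> I \<Longrightarrow> h j = 0" "d = sum h I"
    using assms(1) unfolding degree_zero_def by (elim graded_sumE) blast
  let ?m = "int m"
  \<comment> \<open>\<open>y j\<close> is the component of degree \<open>j\<close> of the product; its support lies in \<open>?I\<close>\<close>
  let ?I = "I \<union> (\<lambda>j. j + ?m) ` I \<union> (\<lambda>j. j - ?m) ` I"
  define y where "y j = h j * casimir - a \<bullet> h (j - ?m) * Kpow ?m - b \<bullet> h (j + ?m) * Kpow (- ?m)"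
    for j
  have casimir_part: "casimir \<in> torus_part 0"
    by (rule torus_partI[OF casimir_central]) simp
  have y_part: "y j \<in> torus_part j" for j
    using torus_part_mult[OF h(2)[of j] casimir_part]
      torus_part_mult[OF h(2)[of "j - ?m"] Kpow_in_torus_part[of ?m]]
      torus_part_mult[OF h(2)[of "j + ?m"] Kpow_in_torus_part[of "- ?m"]]
    unfolding y_def by (auto intro!: torus_part_diff torus_part_scale)
  have "finite ?I"
    using h(1) by simp
  have shift: "(\<Sum>j\<in>?I. h (j + s)) = d" if "(\<lambda>j. j - s) ` I \<subseteq> ?I" for s
  proof -
    have "(\<Sum>j\<in>?I. h (j + s)) = (\<Sum>j\<in>(\<lambda>j. j - s) ` I. h (j + s))"
    proof (rule sum.mono_neutral_right[OF \<open>finite ?I\<close> that], intro ballI h(3) notI)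
      fix j assume "j \<in> ?I - (\<lambda>j. j - s) ` I" "j + s \<in> I"
      then show False by (auto simp: image_iff)
    qed
    also have "\<dots> = d"
      by (simp add: sum.reindex inj_on_def h(4))
    finally show ?thesis .
  qed
  have "sum y ?I = (\<Sum>j\<in>?I. h (j + 0)) * casimir - (\<Sum>j\<in>?I. h (j + - ?m)) * (a \<bullet> Kpow ?m)
      - (\<Sum>j\<in>?I. h (j + ?m)) * (b \<bullet> Kpow (- ?m))"
    by (simp add: y_def sum_subtractf sum_distrib_right del: mult_scale_right)
       (simp add: sum_distrib_right)
  also have "(\<Sum>j\<in>?I. h (j + 0)) = d"
    by (rule shift) auto
  also have "(\<Sum>j\<in>?I. h (j + - ?m)) = d"
    by (rule shift) auto
  also have "(\<Sum>j\<in>?I. h (j + ?m)) = d"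
    by (rule shift) auto
  also have "d * casimir - d * (a \<bullet> Kpow ?m) - d * (b \<bullet> Kpow (- ?m)) =
      d * (casimir - a \<bullet> Kpow ?m - b \<bullet> Kpow (- ?m))"
    by (simp only: right_diff_distrib)
  finally have "sum y ?I \<in> S"
    using dt by simp
  then have "y j \<in> S" if "j \<in> ?I" for j
    using torus_components_in[OF \<open>finite ?I\<close> y_part] that by blast
  have h_in: "h j \<in> S" for j
  proof (rule ccontr)
    assume "h j \<notin> S"
    define B where "B = {j. h j \<notin> S}"
    have "B \<subseteq> I"
      using h(3) S_D(2) unfolding B_def by (metis mem_Collect_eq subsetI)
    with h(1) have fin: "finite B" by (rule finite_subset[rotated])
    have "B \<noteq> {}"
      using \<open>h j \<notin> S\<close> by (auto simp: B_def)
    define k where "k = Max B"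
    have "k \<in> B"
      unfolding k_def by (rule Max_in[OF fin \<open>B \<noteq> {}\<close>])
    have above: "h j \<in> S" if "j > k" for j
      using Max_ge[OF fin, of j] that by (force simp: B_def k_def)
    have "k + ?m \<in> ?I"
      using \<open>k \<in> B\<close> \<open>B \<subseteq> I\<close> by auto
    then have "y (k + ?m) \<in> S" by fact
    moreover have "h (k + ?m) * casimir \<in> S"
      using above m_positive by (intro torus_part_mult_right_in[OF _ h(2) casimir_part]) simp
    moreover have "h (k + ?m + ?m) * Kpow (- ?m) \<in> S"
      using above m_positive by (intro torus_part_mult_right_in[OF _ h(2) Kpow_in_torus_part]) simp
    then have "b \<bullet> h (k + ?m + ?m) * Kpow (- ?m) \<in> S"
      using S_D(5) by simp
    ultimately have "(h (k + ?m) * casimir - b \<bullet> h (k + ?m + ?m) * Kpow (- ?m)) - y (k + ?m) \<in> S"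
      by (intro S_D(7))
    then have "a \<bullet> h k * Kpow ?m \<in> S"
      by (simp add: y_def)
    then have "inverse a \<bullet> Kpow (- ?m) * (a \<bullet> h k * Kpow ?m) \<in> S"
      by (rule S_D(4))
    then have "Kpow (- ?m) * (h k * Kpow ?m) \<in> S"
      using \<open>a \<noteq> 0\<close> by simp
    moreover have "h k \<asymp> Kpow (- ?m) * (h k * Kpow ?m)"
    proof -
      have "Kpow (- ?m) * (h k * Kpow ?m) \<asymp> Kpow (- ?m) * Kpow ?m * h k"
        unfolding mult.assoc by (intro cong_left torus_part_commute[OF h(2) Kpow_in_torus_part])
      also have "\<dots> \<asymp> Kpow (- ?m + ?m) * h k"
        by (intro cong_right Kpow_add)
      finally show ?thesis by (auto intro: cong_sym)
    qed
    ultimately have "h k \<in> S"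
      by (rule S_cong[rotated])
    then show False
      using \<open>k \<in> B\<close> by (simp add: B_def)
  qed
  have "sum h I \<in> S"
    using h(1) by (induction I rule: finite_induct) (auto intro: S_D(2,3) h_in)
  then show ?thesis
    by (simp add: h(4))
qed

text \<open>
  The largest two-sided ideal inside \<open>S\<close>.  If \<open>S\<close> is the annihilator of a generator of a module, this
  is the annihilator of the whole module.
\<close>
definition annihilator :: "'a set"
  where "annihilator = {x. \<forall>u. x * u \<in> S}"

lemma annihilator_in_S: "x \<in> annihilator \<Longrightarrow> x \<in> S"
  unfolding annihilator_def using mult_1_right[of x] by (metis mem_Collect_eq)

lemma annihilator_right: "x \<in> annihilator \<Longrightarrow> x * a \<in> annihilator"
  by (simp add: annihilator_def mult.assoc)

lemma left_ideal_annihilator: "left_ideal annihilator"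
  unfolding left_ideal_def annihilator_def
  by (auto simp: distrib_right mult.assoc intro: S_D(1,3,4) J_right)

lemmas annihilator_D = left_idealD[OF left_ideal_annihilator]
lemmas annihilator_cong = cong_in[OF left_ideal_annihilator]

text \<open>
  The annihilator is two-sided, hence stable under conjugation by \<open>K\<close>, whose eigenvalues on different
  weights are distinct.
\<close>
lemma weight_components_in:
  assumes "finite I" "\<And>n. h n \<in> weight_part n" "sum h I \<in> annihilator" "n \<in> I"
  shows "h n \<in> annihilator"
proof (rule eigencomponents_in[OF left_ideal_annihilator, of "\<lambda>x. K * x * L" I qpow h])
  show "inj_on qpow I"
    using inj_qpow by (rule inj_on_subset) simp
next
  fix n
  obtain d where d: "d \<in> degree_zero" "h n \<asymp> d * EFpow n"
    using assms(2)[of n] by (auto simp: weight_part_def)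
  have "twisted 0 d"
    using degree_zero_commute[OF d(1) Kpow_in_degree_zero[of 1]] by (simp add: twisted_def cong_sym)
  from twisted_mult[OF this twisted_EFpow[of n]]
  have tw: "K * (d * EFpow n) \<asymp> qpow n \<bullet> (d * EFpow n * K)"
    by (simp add: twisted_def)
  have "K * h n * L \<asymp> K * (d * EFpow n) * L"
    by (intro cong_right cong_left d)
  also have "\<dots> \<asymp> qpow n \<bullet> (d * EFpow n * K) * L"
    by (intro cong_right tw)
  also have "\<dots> = qpow n \<bullet> (d * EFpow n) * (K * L)"
    by (simp add: mult.assoc)
  also have "\<dots> \<asymp> qpow n \<bullet> h n * 1"
    by (intro cong_scale cong_trans[OF cong_left[OF KL] cong_right] cong_sym[OF d(2)])
  finally show "K * h n * L - qpow n \<bullet> h n \<in> annihilator"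
    by (intro annihilator_D(1)) (simp add: cong_def)
qed (simp_all add: assms distrib_left distrib_right annihilator_D(4) annihilator_right)

lemma E_power_minus: "E ^ k - e ^ k \<bullet> 1 \<in> S"
proof (induction k)
  case 0
  then show ?case by (simp add: S_D)
next
  case (Suc k)
  have "E ^ Suc k - e ^ Suc k \<bullet> 1 = E ^ k * (E - e \<bullet> 1) + e \<bullet> (E ^ k - e ^ k \<bullet> 1)"
    by (simp add: right_diff_distrib scale_diff_right power_commutes)
  also have "\<dots> \<in> S"
    by (intro S_D(3) S_D(4)[OF E_minus_e] S_D(5)[OF Suc])
  finally show ?case .
qed

text \<open>
  On the Whittaker vector \<open>E\<^sup>k\<close> acts as the nonzero scalar \<open>e\<^sup>k\<close>.
\<close>
lemma positive_weight:
  assumes "d * E ^ k \<in> S"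
  shows "d \<in> S"
proof -
  have "d * E ^ k - d * (E ^ k - e ^ k \<bullet> 1) \<in> S"
    by (intro S_D(7) assms S_D(4) E_power_minus)
  then have "e ^ k \<bullet> d \<in> S"
    by (simp add: right_diff_distrib)
  then show ?thesis
    using S_D(5)[of "e ^ k \<bullet> d" "inverse (e ^ k)"] e_nonzero by simp
qed

text \<open>
  The powers of \<open>F\<close> do not act on the Whittaker vector by scalars, but the annihilator is two-sided, and
  multiplying by \<open>E\<close> on the right turns one factor \<open>F\<close> into \<open>F * E\<close>.  Written with the Casimir
  element and moved to the left of the remaining power of \<open>F\<close>, this is a factor of the form treated in
  \<open>degree_zero_cancel\<close>.
\<close>
lemma negative_weight:
  assumes "d \<in> degree_zero" "d * F ^ k \<in> annihilator"
  shows "d \<in> S"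
  using assms
proof (induction k arbitrary: d)
  case 0
  then show ?case by (simp add: annihilator_in_S)
next
  case (Suc k)
  let ?m = "int m"
  \<comment> \<open>\<open>?t\<close> is the result of moving \<open>F * E\<close> to the left of \<open>F\<^sup>k\<close>\<close>
  let ?a = "cas_pos * qpow (int k * ?m)" and ?b = "cas_neg * qpow (- int k * ?m)"
  let ?t = "casimir - ?a \<bullet> Kpow ?m - ?b \<bullet> Kpow (- ?m)"
  have t: "?t \<in> degree_zero"
    by (intro degree_zero_diff degree_zero_scale centre_in_degree_zero casimir_central
        Kpow_in_degree_zero)
  have FK: "F ^ k * Kpow ?m \<asymp> qpow (int k * ?m) \<bullet> (Kpow ?m * F ^ k)"
    "F ^ k * Kpow (- ?m) \<asymp> qpow (- int k * ?m) \<bullet> (Kpow (- ?m) * F ^ k)"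
    using twisted_Kpow[OF twisted_F_power[of k], of ?m]
      twisted_Kpow[OF twisted_F_power[of k], of "- ?m"] by simp_all
  have "F ^ k * (F * E) = F ^ k * casimir - cas_pos \<bullet> (F ^ k * Kpow ?m)
      - cas_neg \<bullet> (F ^ k * Kpow (- ?m))"
    unfolding FE_eq by (simp add: right_diff_distrib)
  also have "\<dots> \<asymp> casimir * F ^ k - cas_pos \<bullet> qpow (int k * ?m) \<bullet> (Kpow ?m * F ^ k)
      - cas_neg \<bullet> qpow (- int k * ?m) \<bullet> (Kpow (- ?m) * F ^ k)"
    by (intro cong_diff cong_scale FK cong_sym[OF centreD] casimir_central)
  also have "\<dots> = ?t * F ^ k"
    by (simp add: left_diff_distrib)
  finally have "F ^ k * (F * E) \<asymp> ?t * F ^ k" .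
  then have "d * ?t * F ^ k \<asymp> d * (F ^ k * (F * E))"
    unfolding mult.assoc by (rule cong_left[OF cong_sym])
  moreover have "d * (F ^ k * (F * E)) \<in> annihilator"
    using annihilator_right[OF Suc.prems(2), of E] by (simp add: mult.assoc power_Suc2 del: power_Suc)
  ultimately have "d * ?t * F ^ k \<in> annihilator"
    by (rule annihilator_cong)
  then have "d * ?t \<in> S"
    by (rule Suc.IH[OF degree_zero_mult[OF Suc.prems(1) t]])
  then show ?case
    by (rule degree_zero_cancel[OF Suc.prems(1), rotated]) (simp add: cas_pos)
qed

text \<open>
  The conclusion says that \<open>annihilator\<close> lies in the left ideal generated by the central elements
  of \<open>S\<close>: every set \<open>C\<close> with the closure properties of that ideal contains it.  After separating weights
  an element has the form \<open>d * EFpow n\<close>, and \<open>d\<close> lies in \<open>S\<close>.  Its components \<open>K\<^sup>j z\<close> lie in \<open>S\<close>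
  as well, hence so do the central elements \<open>z\<close>.
\<close>
theorem annihilator_centrally_generated:
  assumes "x \<in> annihilator"
    and C_J: "J \<subseteq> C"
    and C_add: "\<And>x y. x \<in> C \<Longrightarrow> y \<in> C \<Longrightarrow> x + y \<in> C"
    and C_mult: "\<And>u z. z \<in> centre \<Longrightarrow> z \<in> S \<Longrightarrow> u * z \<in> C"
  shows "x \<in> C"
proof -
  have C_cong: "x \<in> C" if "x \<asymp> y" "y \<in> C" for x y
    using C_add[of "x - y" y] C_J that by (auto simp: cong_def)
  have C_sum: "sum g I \<in> C" if "finite I" "\<And>n. n \<in> I \<Longrightarrow> g n \<in> C" for g :: "int \<Rightarrow> 'a" and I
    using that by (induction I rule: finite_induct) (use C_add C_J J_zero in auto)
  have weight: "x \<in> C" if "x \<in> annihilator" "x \<in> weight_part n" for x n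
  proof -
    obtain d where d: "d \<in> degree_zero" "x \<asymp> d * EFpow n"
      using \<open>x \<in> weight_part n\<close> by (auto simp: weight_part_def)
    have "d * EFpow n \<in> annihilator"
      using cong_sym[OF d(2)] that(1) by (rule annihilator_cong)
    then have "d \<in> S"
      using d(1)
      by (cases n rule: int_cases2) (auto intro: positive_weight negative_weight annihilator_in_S)
    obtain I h where h: "finite I" "\<And>j. h j \<in> torus_part j" "d = sum h I"
      using d(1) unfolding degree_zero_def by (elim graded_sumE) blast
    have "h j * EFpow n \<in> C" if "j \<in> I" for j
    proof -
      obtain z where z: "z \<in> centre" "h j \<asymp> Kpow j * z"
        using h(2)[of j] by (auto simp: torus_part_def)
      have "h j \<in> S"
        using torus_components_in[OF h(1,2), of j] \<open>d \<in> S\<close> h(3) that by simp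
      have "Kpow (- j) * h j \<asymp> Kpow (- j) * Kpow j * z"
        unfolding mult.assoc by (intro cong_left z)
      also have "\<dots> \<asymp> Kpow (- j + j) * z"
        by (intro cong_right Kpow_add)
      finally have "z \<asymp> Kpow (- j) * h j"
        by (auto intro: cong_sym)
      then have "z \<in> S"
        by (rule S_cong) (intro S_D(4) \<open>h j \<in> S\<close>)
      have "h j * EFpow n \<asymp> Kpow j * (z * EFpow n)"
        unfolding mult.assoc[symmetric] by (intro cong_right z)
      also have "\<dots> \<asymp> Kpow j * EFpow n * z"
        unfolding mult.assoc by (intro cong_left centreD z)
      finally show ?thesis
        by (rule C_cong) (intro C_mult z \<open>z \<in> S\<close>)
    qed
    then have "d * EFpow n \<in> C"
      unfolding h(3) sum_distrib_right by (intro C_sum h)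
    with d(2) show ?thesis by (rule C_cong)
  qed
  obtain I h where h: "finite I" "\<And>n. h n \<in> weight_part n" "x = sum h I"
    using graded_decomposition[of x] by (elim graded_sumE) blast
  show ?thesis
    unfolding h(3)
  proof (rule C_sum[OF h(1)])
    fix n assume "n \<in> I"
    with h assms(1) have "h n \<in> annihilator"
      by (intro weight_components_in[of I h]) auto
    then show "h n \<in> C"
      using h(2) by (rule weight)
  qed
qed

end

section \<open>The presented algebra and its Whittaker modules\<close>

lemma FreeAlg_simps [simp]:
  "carrier FreeAlg = UNIV" "x \<otimes>\<^bsub>FreeAlg\<^esub> y = x * y" "x \<oplus>\<^bsub>FreeAlg\<^esub> y = x + y"
  "\<one>\<^bsub>FreeAlg\<^esub> = 1" "\<zero>\<^bsub>FreeAlg\<^esub> = 0"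
  by (simp_all add: ring_of_type_algebra_def)

lemma poly_mapping_single_induct [case_names zero single add]:
  assumes "P 0" "\<And>k v. P (Poly_Mapping.single k v)" "\<And>x y. P x \<Longrightarrow> P y \<Longrightarrow> P (x + y)"
  shows "P x"
proof (induction x rule: update_induct)
  case (update f a b)
  have "Poly_Mapping.update a b f = Poly_Mapping.single a b + f"
    using update(1)
    by (auto intro!: poly_mapping_eqI
        simp: lookup_update lookup_add lookup_single in_keys_iff when_def)
  then show ?case using assms update(3) by simp
qed (fact assms)

lemma const_simps: "const (c + d) = const c + const d" "const (c * d) = const c * const d" "const 1 = 1"
  by (simp_all add: const_def single_add mult_single)

lemma const_commute: "const c * x = x * const c"
proof (induction x rule: poly_mapping_single_induct)
  case zero
  then show ?case by simp
next
  case (single k v)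
  then show ?case by (simp add: const_def mult_single mult.commute)
next
  case (add x y)
  then show ?case by (simp add: distrib_left distrib_right)
qed

text \<open>
  A word is the product of its letters because the addition of exponents is concatenation.
\<close>
lemma single_Word: "Poly_Mapping.single (Word gs) c = const c * prod_list (map var gs)"
proof (induction gs)
  case Nil
  then show ?case by (simp add: const_def zero_free_monoid_def)
next
  case (Cons g gs)
  have "Poly_Mapping.single (Word (g # gs)) c = var g * Poly_Mapping.single (Word gs) c"
    by (simp add: var_def mult_single plus_free_monoid_def)
  also have "\<dots> = const c * (var g * prod_list (map var gs))"
    by (simp add: Cons mult.assoc[symmetric] const_commute[of c "var g"])
  finally show ?case by simp
qed

lemma free_alg_induct [case_names one add scale mult]:
  assumes one: "P 1" and add: "\<And>x y. P x \<Longrightarrow> P y \<Longrightarrow> P (x + y)"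
    and scale: "\<And>c x. P x \<Longrightarrow> P (const c * x)"
    and mult: "\<And>g x. P x \<Longrightarrow> P (var g * x)"
  shows "P x"
proof (induction x rule: poly_mapping_single_induct)
  case zero
  from scale[OF one, of 0] show ?case by (simp add: const_def)
next
  case (single w c)
  obtain gs where w: "w = Word gs" by (cases w)
  have "P (prod_list (map var gs))"
    by (induction gs) (auto intro: one mult)
  then show ?case
    unfolding w single_Word by (rule scale)
next
  case (add x y)
  then show ?case by (rule assms(2))
qed

lemma Uq_relations_Uq:
  assumes "q \<noteq> 0" and "\<And>n::nat. n \<ge> 1 \<Longrightarrow> q ^ n \<noteq> 1" and "m \<ge> 1"
  shows "Uq_relations (Uq_ideal q m) (\<lambda>c x. const c * x)
    (var GenE) (var GenF) (var GenK) (var GenKinv) q m"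
proof -
  interpret I: ideal "Uq_ideal q m" FreeAlg
    by (rule ideal_Uq_ideal)
  note I_closed = I.additive_subgroup_axioms[THEN additive_subgroup.zero_closed]
    I.additive_subgroup_axioms[THEN additive_subgroup.a_closed]
  interpret algebra_mod_ideal "Uq_ideal q m" "\<lambda>c x. const c * x"
  proof
    show "x + y \<in> Uq_ideal q m" if "x \<in> Uq_ideal q m" "y \<in> Uq_ideal q m" for x y
      using I_closed(2)[OF that] by simp
    show "a * x \<in> Uq_ideal q m" "x * a \<in> Uq_ideal q m" if "x \<in> Uq_ideal q m" for x a
      using I.I_l_closed[OF that, of a] I.I_r_closed[OF that, of a] by simp_all
    show "x * (const c * y) = const c * (x * y)" for x y c
      by (simp add: mult.assoc[symmetric] const_commute[of c x])
  qed (use I_closed(1) in \<open>simp_all add: const_simps distrib_left distrib_right mult.assoc\<close>)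
  have rel: "x \<in> Uq_ideal q m" if "x \<in> Uq_relators q m" for x
    using that unfolding Uq_ideal_def genideal_def by blast
  show ?thesis
  proof
    fix P :: "free_alg \<Rightarrow> bool" and x
    assume P: "P 1" "\<And>x y. P x \<Longrightarrow> P y \<Longrightarrow> P (x + y)" "\<And>c x. P x \<Longrightarrow> P (const c * x)"
      and gen: "\<And>g x. g \<in> {var GenE, var GenF, var GenK, var GenKinv} \<Longrightarrow> P x \<Longrightarrow> P (g * x)"
    show "P x"
    proof (induction x rule: free_alg_induct)
      case (mult g x)
      then show ?case by (cases g) (auto intro: gen)
    qed (fact P)+
  qed (use assms in \<open>auto simp: cong_def f_poly_def Uq_relators_def intro!: rel\<close>)
qed

lemma Uq_class_simps:
  "Uq_class q m (x * y) = Uq_class q m x \<otimes>\<^bsub>Uq q m\<^esub> Uq_class q m y"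
  "Uq_class q m (x + y) = Uq_class q m x \<oplus>\<^bsub>Uq q m\<^esub> Uq_class q m y"
  "Uq_class q m x \<in> carrier (Uq q m)"
  using ring_hom_mult[OF Uq_class_ring_hom, of x y] ring_hom_add[OF Uq_class_ring_hom, of x y]
    ring_hom_closed[OF Uq_class_ring_hom, of x] by simp_all

lemma Uq_class_surj:
  assumes "u \<in> carrier (Uq q m)"
  obtains x where "u = Uq_class q m x"
  using assms by (auto simp: Uq_def FactRing_def A_RCOSETS_def' Uq_class_def)

lemma Uq_class_zero:
  assumes "x \<in> Uq_ideal q m"
  shows "Uq_class q m x = \<zero>\<^bsub>Uq q m\<^esub>"
proof -
  interpret I: ideal "Uq_ideal q m" FreeAlg
    by (rule ideal_Uq_ideal)
  show ?thesis
    using assms by (simp add: Uq_class_def Uq_def FactRing_def I.a_rcos_const)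
qed

lemma Uq_class_eq_iff: "Uq_class q m x = Uq_class q m y \<longleftrightarrow> x - y \<in> Uq_ideal q m"
proof -
  interpret I: ideal "Uq_ideal q m" FreeAlg
    by (rule ideal_Uq_ideal)
  interpret U: ring "Uq q m"
    by (rule ring_Uq)
  show ?thesis
  proof
    assume "x - y \<in> Uq_ideal q m"
    then have "Uq_class q m (x - y) = \<zero>\<^bsub>Uq q m\<^esub>"
      by (rule Uq_class_zero)
    then show "Uq_class q m x = Uq_class q m y"
      using Uq_class_simps(2)[of q m "x - y" y] by (simp add: Uq_class_simps(3))
  next
    assume "Uq_class q m x = Uq_class q m y"
    moreover have "x \<in> Uq_class q m x"
      using I.a_rcos_self[of x] by (simp add: Uq_class_def)
    ultimately have "x \<in> Uq_class q m y" by simp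
    then obtain i where "i \<in> Uq_ideal q m" "x = i + y"
      by (auto simp: Uq_class_def a_r_coset_def')
    then show "x - y \<in> Uq_ideal q m" by simp
  qed
qed

theorem theorem3p12:
  fixes q :: complex and m :: nat
    and \<eta> :: "free_alg set \<Rightarrow> complex"
    and V :: "(free_alg set, 'v, 'x) module_scheme"
  assumes "q \<noteq> 0"
    and "\<And>n::nat. n \<ge> 1 \<Longrightarrow> q ^ n \<noteq> 1"
    and "m \<ge> 1"
    and "Uq_E_character q m \<eta>"
    and "\<eta> (Uq_E q m) \<noteq> 0"
    and "whittaker_module q m \<eta> V"
  shows "Ann (Uq q m) V = carrier (Uq q m) \<cdot>\<^bsub>Uq q m\<^esub> Ann_center (Uq q m) V"
proof -
  let ?U = "Uq q m" and ?cl = "Uq_class q m" and ?e = "\<eta> (Uq_E q m)"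
  interpret left_module ?U V
    using assms(6) by (simp add: whittaker_module_def)
  obtain w where w: "w \<in> carrier V" "?cl (var GenE) \<odot>\<^bsub>V\<^esub> w = ?cl (const ?e) \<odot>\<^bsub>V\<^esub> w"
    and cyclic: "carrier V = {u \<odot>\<^bsub>V\<^esub> w | u. u \<in> carrier ?U}"
    using assms(6)
    by (auto simp: whittaker_module_def whittaker_vector_def Uq_scalar_def Uq_E_def)
  note cl = Uq_class_simps[of q m]
  have zero_smult: "\<zero>\<^bsub>?U\<^esub> \<odot>\<^bsub>V\<^esub> x = \<zero>\<^bsub>V\<^esub>" if "x \<in> carrier V" for x
  proof -
    have "\<zero>\<^bsub>?U\<^esub> \<odot>\<^bsub>V\<^esub> x \<oplus>\<^bsub>V\<^esub> \<zero>\<^bsub>?U\<^esub> \<odot>\<^bsub>V\<^esub> x = \<zero>\<^bsub>?U\<^esub> \<odot>\<^bsub>V\<^esub> x"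
      using smult_l_distr[of "\<zero>\<^bsub>?U\<^esub>" "\<zero>\<^bsub>?U\<^esub>" x] that by simp
    then show ?thesis
      using smult_closed[of "\<zero>\<^bsub>?U\<^esub>" x] that M.add.l_cancel_one by simp
  qed
  have smult_zero: "u \<odot>\<^bsub>V\<^esub> \<zero>\<^bsub>V\<^esub> = \<zero>\<^bsub>V\<^esub>" if "u \<in> carrier ?U" for u
  proof -
    have "u \<odot>\<^bsub>V\<^esub> \<zero>\<^bsub>V\<^esub> \<oplus>\<^bsub>V\<^esub> u \<odot>\<^bsub>V\<^esub> \<zero>\<^bsub>V\<^esub> = u \<odot>\<^bsub>V\<^esub> \<zero>\<^bsub>V\<^esub>"
      using smult_r_distr[of u "\<zero>\<^bsub>V\<^esub>" "\<zero>\<^bsub>V\<^esub>"] that by simp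
    then show ?thesis
      using smult_closed[of u "\<zero>\<^bsub>V\<^esub>"] that M.add.l_cancel_one by simp
  qed
  \<comment> \<open>the left ideal of representatives of the elements that kill the cyclic vector \<open>w\<close>\<close>
  define S where "S = {x. ?cl x \<odot>\<^bsub>V\<^esub> w = \<zero>\<^bsub>V\<^esub>}"
  interpret Uq_relations "Uq_ideal q m" "\<lambda>c x. const c * x"
    "var GenE" "var GenF" "var GenK" "var GenKinv" q m
    using assms(1-3) by (rule Uq_relations_Uq)
  have left_ideal_S: "left_ideal S"
    using w(1)
    by (auto simp: left_ideal_def S_def Uq_class_zero zero_smult smult_zero cl smult_l_distr smult_assoc)
  interpret whittaker_left_ideal "Uq_ideal q m" "\<lambda>c x. const c * x"
    "var GenE" "var GenF" "var GenK" "var GenKinv" q m S ?e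
  proof
    have "?cl (var GenE - const ?e) \<odot>\<^bsub>V\<^esub> w \<oplus>\<^bsub>V\<^esub> ?cl (const ?e) \<odot>\<^bsub>V\<^esub> w = ?cl (const ?e) \<odot>\<^bsub>V\<^esub> w"
      using smult_l_distr[of "?cl (var GenE - const ?e)" "?cl (const ?e)" w] w
      by (simp add: cl(3) cl(2)[symmetric])
    then have "?cl (var GenE - const ?e) \<odot>\<^bsub>V\<^esub> w = \<zero>\<^bsub>V\<^esub>"
      using w(1) M.add.r_cancel_one by (simp add: cl(3) smult_closed)
    then show "var GenE - const ?e * 1 \<in> S"
      by (simp add: S_def)
  qed (fact left_ideal_S assms(5))+
  have Ann_iff: "?cl x \<in> Ann ?U V \<longleftrightarrow> x \<in> annihilator" for x
  proof
    assume "?cl x \<in> Ann ?U V"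
    then have "x * u \<in> S" for u
      using w(1) by (simp add: Ann_def S_def cl smult_assoc smult_closed)
    then show "x \<in> annihilator"
      by (simp add: annihilator_def)
  next
    assume x: "x \<in> annihilator"
    have "?cl x \<odot>\<^bsub>V\<^esub> v = \<zero>\<^bsub>V\<^esub>" if "v \<in> carrier V" for v
    proof -
      obtain u where "v = ?cl u \<odot>\<^bsub>V\<^esub> w"
        using \<open>v \<in> carrier V\<close> unfolding cyclic by (auto elim: Uq_class_surj)
      moreover have "?cl (x * u) \<odot>\<^bsub>V\<^esub> w = \<zero>\<^bsub>V\<^esub>"
        using x unfolding annihilator_def by (simp add: S_def)
      ultimately show ?thesis
        using w(1) by (simp add: cl smult_assoc)
    qed
    then show "?cl x \<in> Ann ?U V"
      by (simp add: Ann_def cl(3))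
  qed
  have central_iff: "?cl z \<in> ring_center ?U \<longleftrightarrow> z \<in> centre" for z
  proof
    assume "?cl z \<in> ring_center ?U"
    then have "?cl (z * x) = ?cl (x * z)" for x
      by (simp add: ring_center_def cl)
    then show "z \<in> centre"
      by (simp add: centre_def cong_def Uq_class_eq_iff)
  next
    assume "z \<in> centre"
    then have "?cl (z * x) = ?cl (x * z)" for x
      by (simp add: centre_def cong_def Uq_class_eq_iff)
    then show "?cl z \<in> ring_center ?U"
      by (auto simp: ring_center_def cl elim: Uq_class_surj)
  qed
  show ?thesis
  proof (intro equalityI subsetI)
    fix u assume "u \<in> carrier ?U \<cdot>\<^bsub>?U\<^esub> Ann_center ?U V"
    then show "u \<in> Ann ?U V"
      by induction (auto simp: Ann_center_def Ann_def smult_assoc smult_l_distr smult_zero)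
  next
    fix u assume u: "u \<in> Ann ?U V"
    then obtain x where x: "u = ?cl x"
      by (auto simp: Ann_def elim: Uq_class_surj)
    let ?C = "{x. ?cl x \<in> carrier ?U \<cdot>\<^bsub>?U\<^esub> Ann_center ?U V}"
    have "x \<in> ?C"
    proof (rule annihilator_centrally_generated)
      show "x \<in> annihilator"
        using u Ann_iff x by simp
      show mult: "u * z \<in> ?C" if "z \<in> centre" "z \<in> S" for u z
      proof -
        have "z \<in> annihilator"
          unfolding annihilator_def using S_cong[OF centreD[OF that(1)] S_D(4)[OF that(2)]] by blast
        then have "?cl z \<in> Ann_center ?U V"
          using that(1) by (simp add: Ann_center_def Ann_iff central_iff)
        then show ?thesis
          by (auto simp: cl intro: ideal_prod.prod)
      qed
      show "Uq_ideal q m \<subseteq> ?C"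
      proof
        fix z assume "z \<in> Uq_ideal q m"
        from mult[OF centre_J[OF this] S_D(1)[OF this], of 1] show "z \<in> ?C" by simp
      qed
      show "x + y \<in> ?C" if "x \<in> ?C" "y \<in> ?C" for x y
        using that by (auto simp: cl intro: ideal_prod.sum)
    qed
    then show "u \<in> carrier ?U \<cdot>\<^bsub>?U\<^esub> Ann_center ?U V"
      by (simp add: x)
  qed
qed

end
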